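(* There exists a constant $C\in(0,\infty)$ such that, for every $\beta\ge1$, $$\sup_{x\ge0}\ \psi_{0,\beta}(x)\,\big|\psi_{0,\beta}(x)-\psi_{1,\beta}(x)\big|\le C\,\beta^{3/2}\,(E_{1,\beta}-E_{0,\beta}).$$
   Context: $W(x)=\frac12(x^2-1)^2$. For $\beta>0$, $H_\beta=-\frac1{2\beta}\frac{d^2}{dx^2}+\beta W$ is the selfadjoint Schrödinger operator on $L^2(\mathbb R)$ (with core $C^2_c(\mathbb R)$); it has purely discrete spectrum. $E_{0,\beta}<E_{1,\beta}<\cdots$ are its eigenvalues in increasing order and $\psi_{k,\beta}$, $k\ge0$, a corresponding orthonormal basis of real eigenfunctions of $L^2(\mathbb R)$, satisfying $\psi_{k,\beta}(-x)=(-1)^k\psi_{k,\beta}(x)$, with the ground state $\psi_{0,\beta}$ chosen positive and $\psi_{1,\beta}$ chosen positive on $(0,\infty)$. *)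

theory Defs
  imports "HOL-Analysis.Analysis"
begin

definition double_well :: "real \<Rightarrow> real" where
  "double_well x = (x\<^sup>2 - 1)\<^sup>2 / 2"

text \<open>
  The Hilbert space \<open>L\<^sup>2(\<real>)\<close> over the complex numbers is handled through representatives: elements are
  functions, and equality in \<open>L\<^sup>2(\<real>)\<close> is equality almost everywhere.
\<close>

definition L2_fun :: "(real \<Rightarrow> complex) set" where
  "L2_fun = {f \<in> borel_measurable lborel. integrable lborel (\<lambda>x. (cmod (f x))\<^sup>2)}"

definition L2_inner :: "(real \<Rightarrow> complex) \<Rightarrow> (real \<Rightarrow> complex) \<Rightarrow> complex" where
  "L2_inner f g = (LINT x|lborel. cnj (f x) * g x)"

definition L2_norm :: "(real \<Rightarrow> complex) \<Rightarrow> real" where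
  "L2_norm f = sqrt (LINT x|lborel. (cmod (f x))\<^sup>2)"

definition C2c :: "(real \<Rightarrow> complex) set" where
  "C2c = {f. (\<exists>f' f''. (\<forall>x. (f has_vector_derivative f' x) (at x)) \<and>
                       (\<forall>x. (f' has_vector_derivative f'' x) (at x)) \<and>
                       continuous_on UNIV f'') \<and>
             compact (closure {x. f x \<noteq> 0})}"

text \<open>The differential expression; it is meaningful for twice differentiable functions only.\<close>

definition schroedinger_expr :: "real \<Rightarrow> (real \<Rightarrow> complex) \<Rightarrow> real \<Rightarrow> complex" where
  "schroedinger_expr \<beta> f x =
     - of_real (1 / (2 * \<beta>)) * vector_derivative (\<lambda>y. vector_derivative f (at y)) (at x)
     + of_real (\<beta> * double_well x) * f x"

text \<open>
  A selfadjoint operator with core \<open>C2c\<close> is the closure of its restriction to \<open>C2c\<close>. The operator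
  \<open>H\<^sub>\<beta>\<close> is given here by its graph, the \<open>L\<^sup>2 \<times> L\<^sup>2\<close>-closure of the graph of the differential
  expression on \<open>C2c\<close>: the pair \<open>(f, g)\<close> is a member iff \<open>f\<close> lies in the operator domain
  and \<open>H\<^sub>\<beta> f = g\<close> almost everywhere.
\<close>

definition H_graph :: "real \<Rightarrow> ((real \<Rightarrow> complex) \<times> (real \<Rightarrow> complex)) set" where
  "H_graph \<beta> = {(f, g). f \<in> L2_fun \<and> g \<in> L2_fun \<and>
     (\<exists>\<phi> :: nat \<Rightarrow> real \<Rightarrow> complex. (\<forall>n. \<phi> n \<in> C2c) \<and>
        (\<lambda>n. L2_norm (\<lambda>x. \<phi> n x - f x)) \<longlonglongrightarrow> 0 \<and>
        (\<lambda>n. L2_norm (\<lambda>x. schroedinger_expr \<beta> (\<phi> n) x - g x)) \<longlonglongrightarrow> 0)}"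

definition H_eigenvalues :: "real \<Rightarrow> complex set" where
  "H_eigenvalues \<beta> =
     {z. \<exists>f. (f, \<lambda>x. z * f x) \<in> H_graph \<beta> \<and> \<not> (AE x in lborel. f x = 0)}"

definition L2_orthonormal_basis :: "(nat \<Rightarrow> real \<Rightarrow> complex) \<Rightarrow> bool" where
  "L2_orthonormal_basis e \<longleftrightarrow>
     (\<forall>k. e k \<in> L2_fun) \<and>
     (\<forall>j k. L2_inner (e j) (e k) = (if j = k then 1 else 0)) \<and>
     (\<forall>f\<in>L2_fun. \<forall>\<epsilon>>0. \<exists>(n::nat) (c :: nat \<Rightarrow> complex).
        L2_norm (\<lambda>x. f x - (\<Sum>k<n. c k * e k x)) < \<epsilon>)"

text \<open>
  Pointwise statements about eigenfunctions (positivity, parity, suprema) refer to the continuous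
  representative of the \<open>L\<^sup>2\<close>-class, whence the continuity requirement below. Strict monotonicity of
  \<open>E\<close> encodes that every eigenvalue is simple.
\<close>

definition eigensystem :: "real \<Rightarrow> (nat \<Rightarrow> real) \<Rightarrow> (nat \<Rightarrow> real \<Rightarrow> real) \<Rightarrow> bool" where
  "eigensystem \<beta> E \<psi> \<longleftrightarrow>
     strict_mono E \<and>
     H_eigenvalues \<beta> = range (\<lambda>k. complex_of_real (E k)) \<and>
     (\<forall>k. continuous_on UNIV (\<psi> k)) \<and>
     (\<forall>k. (\<lambda>x. of_real (\<psi> k x), \<lambda>x. of_real (E k) * of_real (\<psi> k x)) \<in> H_graph \<beta>) \<and>
     L2_orthonormal_basis (\<lambda>k x. of_real (\<psi> k x)) \<and>
     (\<forall>k x. \<psi> k (- x) = (- 1) ^ k * \<psi> k x) \<and>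
     (\<forall>x. \<psi> 0 x > 0) \<and>
     (\<forall>x>0. \<psi> 1 x > 0)"

end

theory Submission
  imports Defs
begin

text \<open>
  Write \<open>\<phi> = \<psi>\<^sub>1 / \<psi>\<^sub>0\<close> and \<open>\<delta> = E\<^sub>1 - E\<^sub>0\<close>. The Wronskian identity gives \<open>\<phi>' = 2 \<beta> \<delta> S / \<psi>\<^sub>0\<^sup>2\<close> with
  \<open>S\<close> the tail integral of \<open>\<psi>\<^sub>0 \<psi>\<^sub>1\<close>, so \<open>\<phi>\<close> increases on the half line, where both functions have mass
  \<open>1/2\<close>. Averaging \<open>\<phi>(y)\<^sup>2 - \<phi>(x)\<^sup>2\<close> against \<open>\<psi>\<^sub>0\<^sup>2\<close> over \<open>y > x\<close>, or \<open>\<phi>(x) - \<phi>(y)\<close> over \<open>y < x\<close>,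
  bounds \<open>|1 - \<phi>(x)|\<close> by a multiple of \<open>\<beta> \<delta>\<close>, weighted by ratios of \<open>\<psi>\<^sub>0\<close> which are controlled because
  \<open>\<psi>\<^sub>0\<close> is unimodal with exponential decay. The remaining factor \<open>\<beta>\<^bsup>1/2\<^esup>\<close> is the bound on \<open>sup \<psi>\<^sub>0\<^sup>2\<close>.
  The energies are at most \<open>6\<close> by Sturm comparison, so no spectral theory is needed.
\<close>

subsection \<open>Positive solutions on the half line\<close>

text \<open>This replaces comparison of tail integrals: two quantities vanishing at infinity are
  compared through their derivatives alone, the limit fixing the constant of integration.\<close>

lemma nonneg_of_antitone_tendsto_0:
  fixes g :: "real \<Rightarrow> real"
  assumes deriv: "\<And>y. y \<ge> a \<Longrightarrow> (g has_real_derivative g' y) (at y)"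
    and nonpos: "\<And>y. y \<ge> a \<Longrightarrow> g' y \<le> 0"
    and lim: "(g \<longlongrightarrow> 0) at_top" and "x \<ge> a"
  shows "g x \<ge> 0"
proof (rule tendsto_upperbound[OF lim])
  show "\<forall>\<^sub>F y in at_top. g y \<le> g x"
    using eventually_ge_at_top[of x]
  proof eventually_elim
    case (elim y)
    show ?case
      by (rule DERIV_nonpos_imp_nonincreasing[OF elim])
        (meson deriv nonpos \<open>x \<ge> a\<close> order_trans)
  qed
qed simp

lemma increment_le_by_derivative:
  fixes g :: "real \<Rightarrow> real"
  assumes "a \<le> b"
    and deriv: "\<And>y. a \<le> y \<Longrightarrow> y \<le> b \<Longrightarrow> (g has_real_derivative g' y) (at y)"
    and bound: "\<And>y. a \<le> y \<Longrightarrow> y \<le> b \<Longrightarrow> g' y \<le> c"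
  shows "g b - g a \<le> c * (b - a)"
proof -
  have "g b - c * b \<le> g a - c * a"
  proof (rule DERIV_nonpos_imp_nonincreasing[OF \<open>a \<le> b\<close>])
    fix y assume y: "a \<le> y" "y \<le> b"
    have "((\<lambda>y. g y - c * y) has_real_derivative g' y - c) (at y)"
      by (auto intro!: derivative_eq_intros deriv y)
    then show "\<exists>z. ((\<lambda>y. g y - c * y) has_real_derivative z) (at y) \<and> z \<le> 0"
      using bound[OF y] by auto
  qed
  then show ?thesis by (simp add: algebra_simps)
qed

lemma mono_by_derivative:
  fixes g :: "real \<Rightarrow> real"
  assumes "a \<le> b"
    and "\<And>y. a \<le> y \<Longrightarrow> y \<le> b \<Longrightarrow> (g has_real_derivative g' y) (at y)"
    and "\<And>y. a \<le> y \<Longrightarrow> y \<le> b \<Longrightarrow> 0 \<le> g' y"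
  shows "g a \<le> g b"
  using DERIV_nonneg_imp_nondecreasing[of a b g] assms by blast

text \<open>\<open>T\<close> is the mass of \<open>f\<^sup>2\<close> beyond \<open>x\<close>,
  encoded by its derivative, initial value and limit so that no improper integrals occur. The value
  1/2 at 0 reflects parity. Positivity is required only for \<open>x > 0\<close> because the odd
  state vanishes at 0.\<close>

locale half_line_state =
  fixes \<beta> E :: real and f f' T :: "real \<Rightarrow> real"
  assumes beta: "\<beta> \<ge> 1"
    and f_deriv: "x \<ge> 0 \<Longrightarrow> (f has_real_derivative f' x) (at x)"
    and f'_deriv: "x \<ge> 0 \<Longrightarrow>
      (f' has_real_derivative 2 * \<beta> * (\<beta> * double_well x - E) * f x) (at x)"
    and T_deriv: "x \<ge> 0 \<Longrightarrow> (T has_real_derivative - (f x)\<^sup>2) (at x)"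
    and T_0: "T 0 = 1 / 2"
    and T_lim: "(T \<longlongrightarrow> 0) at_top"
    and f_pos: "x > 0 \<Longrightarrow> f x > 0"
begin

lemma f_nonneg: "x \<ge> 0 \<Longrightarrow> f x \<ge> 0"
proof -
  assume "x \<ge> 0"
  have "(f \<longlongrightarrow> f 0) (at_right 0)"
    using DERIV_isCont[OF f_deriv[of 0]] by (auto simp: isCont_def intro: tendsto_mono[OF at_le])
  then have "f 0 \<ge> 0"
    by (rule tendsto_lowerbound) (auto intro!: eventually_at_right_less eventually_mono[OF eventually_at_right_less] less_imp_le f_pos)
  then show ?thesis using f_pos[of x] \<open>x \<ge> 0\<close> by (cases "x = 0") auto
qed

lemma T_nonneg: "x \<ge> 0 \<Longrightarrow> T x \<ge> 0"
  by (rule nonneg_of_antitone_tendsto_0[of 0 T, OF T_deriv _ T_lim]) auto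

lemma T_le_half: "x \<ge> 0 \<Longrightarrow> T x \<le> 1 / 2"
  using increment_le_by_derivative[of 0 x T "\<lambda>x. - (f x)\<^sup>2" 0] T_deriv T_0 by auto

lemma T_pos: "x \<ge> 0 \<Longrightarrow> T x > 0"
proof (rule ccontr)
  assume x: "x \<ge> 0" "\<not> T x > 0"
  then have "T x = 0" using T_nonneg[of x] by simp
  moreover have "T (x + 1) < T x"
  proof (rule DERIV_neg_imp_decreasing_open[of x "x + 1" T])
    fix y assume "x < y" "y < x + 1"
    then show "\<exists>z. (T has_real_derivative z) (at y) \<and> z < 0"
      using T_deriv[of y] f_pos[of y] x
      by (intro exI[of _ "- (f y)\<^sup>2"]) auto
  qed (use x in \<open>auto intro!: continuous_at_imp_continuous_on DERIV_isCont[OF T_deriv]\<close>)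
  ultimately show False using T_nonneg[of "x + 1"] x by simp
qed

text \<open>
  Sturm comparison with a cosine on \<open>[1 - \<beta>\<^bsup>-1/2\<^esup>, 1 + \<beta>\<^bsup>-1/2\<^esup>]\<close>, where
  \<open>\<beta> W \<le> 9/2\<close>: if \<open>E > 6\<close>, then \<open>f\<close> would change sign there.
\<close>

lemma E_le_6: "E \<le> 6"
proof (rule ccontr)
  assume "\<not> E \<le> 6"
  then have E: "E > 6" by simp
  define r where "r = 1 / sqrt \<beta>"
  \<comment> \<open>The relation \<open>q * r = pi / 2\<close> puts the zeros of the cosine at the
    endpoints \<open>1 - r\<close> and \<open>1 + r\<close>.\<close>
  define q where "q = pi / 2 * sqrt \<beta>"
  have r: "0 < r" "r \<le> 1" and r2: "\<beta> * r\<^sup>2 = 1"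
    using beta by (auto simp: r_def power_divide)
  have q: "q > 0" "q * r = pi / 2" using beta by (auto simp: q_def r_def)
  have "pi * pi \<le> 3.2 * 3.2"
    using pi_approx pi_gt_zero by (intro mult_mono) auto
  then have "pi\<^sup>2 * \<beta> \<le> 12 * \<beta>"
    using beta by (intro mult_right_mono) (auto simp: power2_eq_square)
  then have q2: "q\<^sup>2 \<le> 3 * \<beta>"
    using beta by (simp add: q_def power_mult_distrib power_divide)
  \<comment> \<open>\<open>D\<close> is the Wronskian of \<open>f\<close> and the cosine. Its
    endpoint values are multiples of \<open>f\<close> with opposite signs, which contradicts
    monotonicity.\<close>
  define D where "D = (\<lambda>x. f' x * cos (q * (x - 1)) + f x * (q * sin (q * (x - 1))))"
  have "D (1 + r) \<le> D (1 - r)"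
  proof (rule DERIV_nonpos_imp_nonincreasing[of "1 - r" "1 + r" D])
    fix x assume x: "1 - r \<le> x" "x \<le> 1 + r"
    then have x0: "x \<ge> 0" using r by simp
    define s where "s = x - 1"
    have s: "\<bar>s\<bar> \<le> r" "\<bar>s + 2\<bar> \<le> 3" using x r by (auto simp: s_def)
    have "x\<^sup>2 - 1 = s * (s + 2)" by (simp add: s_def power2_eq_square algebra_simps)
    then have "\<bar>x\<^sup>2 - 1\<bar> \<le> r * 3" using s r
      by (simp only: abs_mult) (intro mult_mono, auto)
    then have "(x\<^sup>2 - 1)\<^sup>2 \<le> (r * 3)\<^sup>2" by (rule abs_le_square_iff[THEN iffD1, OF order_trans]) simp
    then have "\<beta> * (x\<^sup>2 - 1)\<^sup>2 \<le> \<beta> * (r * 3)\<^sup>2" using beta by (intro mult_left_mono) auto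
    then have W: "\<beta> * double_well x \<le> 9 / 2"
      using r2 by (simp add: double_well_def power_mult_distrib)
    have "q * \<bar>s\<bar> \<le> q * r" using q s by (intro mult_left_mono) auto
    then have "\<bar>q * s\<bar> \<le> pi / 2" using q by (simp add: abs_mult)
    then have c: "cos (q * (x - 1)) \<ge> 0" by (intro cos_ge_zero) (auto simp: s_def abs_le_iff)
    \<comment> \<open>The gap 6 - 9/2 = 3/2 contributes \<open>- 3 * \<beta>\<close>, which just
      compensates \<open>q\<^sup>2 \<le> 3 * \<beta>\<close>.\<close>
    have "2 * \<beta> * (\<beta> * double_well x - E) \<le> 2 * \<beta> * (- 3 / 2)"
      using beta E W by (intro mult_left_mono) auto
    then have "2 * \<beta> * (\<beta> * double_well x - E) + q\<^sup>2 \<le> 0" using q2 by simp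
    then have "(2 * \<beta> * (\<beta> * double_well x - E) + q\<^sup>2) * (f x * cos (q * (x - 1))) \<le> 0"
      using c f_nonneg[OF x0] by (intro mult_nonpos_nonneg) auto
    moreover have "(D has_real_derivative
        (2 * \<beta> * (\<beta> * double_well x - E) + q\<^sup>2) * (f x * cos (q * (x - 1)))) (at x)"
      unfolding D_def
      by (auto intro!: derivative_eq_intros f_deriv f'_deriv x0
          simp: power2_eq_square algebra_simps)
    ultimately show "\<exists>y. (D has_real_derivative y) (at x) \<and> y \<le> 0" by blast
  qed (use r in simp)
  moreover have "D (1 + r) = q * f (1 + r)" "D (1 - r) = - q * f (1 - r)"
    by (simp_all add: D_def q(2))
  moreover have "q * f (1 + r) > 0" "q * f (1 - r) \<ge> 0"
    using q r f_pos[of "1 + r"] f_nonneg[of "1 - r"] by auto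
  ultimately show False by simp
qed

text \<open>Where the potential exceeds the energy, \<open>f\<close> is convex. A positive slope
  would persist, keeping \<open>f\<close> above a positive constant and making its mass
  infinite.\<close>

lemma f'_nonpos:
  assumes "a \<ge> 0" and barrier: "\<And>x. x \<ge> a \<Longrightarrow> E \<le> \<beta> * double_well x" and "x \<ge> a"
  shows "f' x \<le> 0"
proof (rule ccontr)
  assume "\<not> f' x \<le> 0"
  then have pos: "f' x > 0" by simp
  have x0: "x \<ge> 0" using assms by simp
  have f'_ge: "f' x \<le> f' y" if "y \<ge> x" for y
  proof (rule mono_by_derivative[OF that f'_deriv])
    fix z assume z: "x \<le> z" "z \<le> y"
    then have "E \<le> \<beta> * double_well z" using barrier assms by simp
    then show "0 \<le> 2 * \<beta> * (\<beta> * double_well z - E) * f z"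
      using x0 z beta f_nonneg[of z] by auto
  qed (use x0 in auto)
  have f_ge: "f (x + 1) \<le> f y" if "y \<ge> x + 1" for y
  proof (rule mono_by_derivative[OF that f_deriv])
    show "0 \<le> f' z" if "x + 1 \<le> z" for z
      using f'_ge[of z] pos that by simp
  qed (use x0 in auto)
  define c where "c = f (x + 1)"
  have c: "c > 0" using f_pos[of "x + 1"] x0 by (simp add: c_def)
  \<comment> \<open>On an interval of length \<open>d\<close> the mass is at least
    \<open>c\<^sup>2 * d = 1\<close>, more than the available 1/2.\<close>
  define d where "d = 1 / c\<^sup>2"
  have d: "d > 0" "c\<^sup>2 * d = 1" using c by (auto simp: d_def)
  have "T (x + 1 + d) - T (x + 1) \<le> - c\<^sup>2 * (x + 1 + d - (x + 1))"
  proof (rule increment_le_by_derivative)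
    show "- (f y)\<^sup>2 \<le> - c\<^sup>2" if "x + 1 \<le> y" for y
      using f_ge[OF that] c by (simp add: c_def power_mono)
  qed (use d x0 in \<open>auto intro!: T_deriv\<close>)
  then show False using T_nonneg[of "x + 1 + d"] T_le_half[of "x + 1"] d x0 by simp
qed

section \<open>Exponential decay beyond 3\<close>

lemma barrier_ge_1: "x \<ge> 3 \<Longrightarrow> 2 * \<beta> * (\<beta> * double_well x - E) \<ge> 1"
proof -
  assume "x \<ge> 3"
  then have "3 * 3 \<le> x * x" by (intro mult_mono) auto
  then have "8 * 8 \<le> (x\<^sup>2 - 1) * (x\<^sup>2 - 1)" by (intro mult_mono) (auto simp: power2_eq_square)
  then have "double_well x \<ge> 32" by (simp add: double_well_def power2_eq_square)
  then have "1 * 32 \<le> \<beta> * double_well x" using beta by (intro mult_mono) auto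
  \<comment> \<open>The barrier of height 32 dominates the energy bound 6. The resulting inequality
    \<open>f'' \<ge> f\<close> makes \<open>exp (- x)\<close> the comparison function.\<close>
  then have "\<beta> * double_well x - E \<ge> 1" using E_le_6 by simp
  then have "1 * 1 \<le> (2 * \<beta>) * (\<beta> * double_well x - E)" using beta by (intro mult_mono) auto
  then show ?thesis by simp
qed

lemma f'_nonpos_3: "x \<ge> 3 \<Longrightarrow> f' x \<le> 0"
proof (rule f'_nonpos[of 3])
  fix x :: real assume "x \<ge> 3"
  then have "0 < 2 * \<beta> * (\<beta> * double_well x - E)" using barrier_ge_1[of x] by simp
  then show "E \<le> \<beta> * double_well x" using beta by (simp add: zero_less_mult_iff)
qed auto

lemma f''_ge: "x \<ge> 3 \<Longrightarrow> 2 * \<beta> * (\<beta> * double_well x - E) * f x \<ge> f x"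
  using mult_right_mono[OF barrier_ge_1, of x "f x"] f_nonneg[of x] by simp

text \<open>Together with \<open>f'_nonpos_3\<close> this confines the slope beyond 3 to a bounded
  interval, which is how the Wronskian is shown to vanish at infinity.\<close>

lemma f'_ge: "x \<ge> 3 \<Longrightarrow> f' 3 \<le> f' x"
proof (rule mono_by_derivative[OF _ f'_deriv])
  fix y :: real assume "3 \<le> y"
  then show "0 \<le> 2 * \<beta> * (\<beta> * double_well y - E) * f y"
    using order_trans[OF f_nonneg[of y] f''_ge[of y]] by simp
qed auto

lemma f_antimono_3: "3 \<le> x \<Longrightarrow> x \<le> y \<Longrightarrow> f y \<le> f x"
  by (rule DERIV_nonpos_imp_nonincreasing[of x y f])
    (auto intro!: exI[of _ "f' _"] f_deriv f'_nonpos_3)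

text \<open>From \<open>f'' \<ge> f\<close>, the function \<open>exp (- x) * (f' x + f x)\<close> is
  nondecreasing. A positive value would make \<open>f' + f\<close> grow exponentially, although it
  is bounded by the decreasing \<open>f\<close>.\<close>

lemma f'_le_neg_f:
  assumes "x \<ge> 3"
  shows "f' x \<le> - f x"
proof (rule ccontr)
  assume "\<not> f' x \<le> - f x"
  define c where "c = f' x + f x"
  have c: "c > 0" using \<open>\<not> _\<close> by (simp add: c_def)
  \<comment> \<open>At this \<open>y\<close> even the linear bound
    \<open>1 + (y - x) \<le> exp (y - x)\<close> already gives \<open>c + f x\<close>, exceeding the
    upper bound \<open>f x\<close>.\<close>
  define y where "y = x + f x / c"
  have xy: "x \<le> y" using c f_nonneg[of x] assms by (simp add: y_def)
  have "exp (- x) * (f' x + f x) \<le> exp (- y) * (f' y + f y)"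
  proof (rule DERIV_nonneg_imp_nondecreasing[OF xy])
    fix z assume z: "x \<le> z" "z \<le> y"
    have "((\<lambda>z. exp (- z) * (f' z + f z)) has_real_derivative
        exp (- z) * (2 * \<beta> * (\<beta> * double_well z - E) * f z - f z)) (at z)"
      using z assms
      by (auto intro!: derivative_eq_intros f_deriv f'_deriv simp: algebra_simps)
    then show "\<exists>u. ((\<lambda>z. exp (- z) * (f' z + f z)) has_real_derivative u) (at z) \<and> 0 \<le> u"
      using f''_ge[of z] z assms by (intro exI conjI) auto
  qed
  then have "exp (y - x) * c \<le> f' y + f y"
    by (simp add: c_def exp_minus exp_diff field_simps)
  moreover have "f' y + f y \<le> f x" using f'_nonpos_3[of y] f_antimono_3[of x y] xy assms by simp
  moreover have "(1 + (y - x)) * c \<le> exp (y - x) * c"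
    using c by (intro mult_right_mono) auto
  moreover have "(1 + (y - x)) * c = c + f x" using c by (simp add: y_def field_simps)
  ultimately show False using c by simp
qed

text \<open>By \<open>f'_le_neg_f\<close>, \<open>exp x * f x\<close> is nonincreasing from 3
  on.\<close>

lemma f_lim: "(f \<longlongrightarrow> 0) at_top"
proof (rule tendsto_sandwich[where f = "\<lambda>_. 0" and h = "\<lambda>x. exp 3 * f 3 * exp (- x)"])
  have "f x \<le> exp 3 * f 3 * exp (- x)" if "x \<ge> 3" for x
  proof -
    have "exp x * f x \<le> exp 3 * f 3"
    proof (rule DERIV_nonpos_imp_nonincreasing[OF that])
      fix z :: real assume z: "3 \<le> z"
      have "((\<lambda>z. exp z * f z) has_real_derivative exp z * (f' z + f z)) (at z)"
        using z by (auto intro!: derivative_eq_intros f_deriv simp: algebra_simps)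
      then show "\<exists>u. ((\<lambda>z. exp z * f z) has_real_derivative u) (at z) \<and> u \<le> 0"
        using f'_le_neg_f[OF z] by (intro exI conjI) (auto intro: mult_nonneg_nonpos)
    qed
    then show ?thesis by (simp add: exp_minus field_simps)
  qed
  then show "\<forall>\<^sub>F x in at_top. f x \<le> exp 3 * f 3 * exp (- x)"
    by (auto simp: eventually_at_top_linorder)
  show "\<forall>\<^sub>F x in at_top. 0 \<le> f x"
    by (auto simp: eventually_at_top_linorder intro!: exI[of _ 0] f_nonneg)
  have "((\<lambda>x::real. exp (- x)) \<longlongrightarrow> 0) at_top"
    by (rule filterlim_compose[OF exp_at_bot]) (rule filterlim_uminus_at_bot_at_top)
  then show "((\<lambda>x. exp 3 * f 3 * exp (- x)) \<longlongrightarrow> 0) at_top"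
    by (rule tendsto_mult_right_zero)
qed simp

text \<open>Decay at unit rate at least bounds the tail mass by the local density: the difference
  has derivative \<open>f * (f' + f)\<close>, which is nonpositive.\<close>

lemma T_le_f2:
  assumes "x \<ge> 3"
  shows "T x \<le> (f x)\<^sup>2 / 2"
proof -
  have "0 \<le> (f x)\<^sup>2 / 2 - T x"
  proof (rule nonneg_of_antitone_tendsto_0[OF _ _ _ assms])
    fix y :: real assume y: "y \<ge> 3"
    show "((\<lambda>y. (f y)\<^sup>2 / 2 - T y) has_real_derivative f y * (f' y + f y)) (at y)"
      using y by (auto intro!: derivative_eq_intros f_deriv T_deriv
          simp: power2_eq_square algebra_simps)
    show "f y * (f' y + f y) \<le> 0"
      using f'_le_neg_f[OF y] f_nonneg[of y] y by (intro mult_nonneg_nonpos) auto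
  qed (auto intro!: tendsto_eq_intros f_lim T_lim)
  then show ?thesis by simp
qed

end

subsection \<open>Shape and size of the ground state\<close>

text \<open>The two conditions at 0 come from the ground state being even and positive. The first
  starts the sign analysis of \<open>f'\<close>; the second permits division by \<open>f\<close> on
  the closed half line.\<close>

locale half_line_ground_state = half_line_state +
  assumes f'_0: "f' 0 = 0" and f_0: "f 0 > 0"
begin

lemma pos: "x \<ge> 0 \<Longrightarrow> f x > 0"
  using f_pos[of x] f_0 by (cases "x = 0") auto

text \<open>
  On the half line \<open>f''\<close> has the sign of \<open>\<beta> W - E\<close>, hence the sign pattern \<open>+, -, +\<close> (or a final part
  of it), so \<open>f'\<close> starts at zero, increases, decreases and finally increases to zero.
\<close>

lemma unimodal:
  obtains m where "0 \<le> m" "m \<le> 3"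
    "\<And>x. 0 \<le> x \<Longrightarrow> x \<le> m \<Longrightarrow> f' x \<ge> 0" "\<And>x. m \<le> x \<Longrightarrow> f' x \<le> 0"
proof (cases "E \<le> 0")
  case True
  have "f' x \<le> 0" if "x \<ge> 0" for x
  proof (rule f'_nonpos[OF _ _ that])
    fix y :: real
    have "0 \<le> \<beta> * double_well y" using beta by (simp add: double_well_def)
    then show "E \<le> \<beta> * double_well y" using True by simp
  qed simp
  then show ?thesis by (intro that[of 0]) (auto simp: f'_0 dest: order.antisym)
next
  case False
  \<comment> \<open>The turning points, where \<open>\<beta> * double_well x = E\<close>, are given
    by \<open>\<bar>x\<^sup>2 - 1\<bar> = s\<close>.\<close>
  define s where "s = sqrt (2 * E / \<beta>)"
  have s: "s \<ge> 0" and s2: "\<beta> * s\<^sup>2 / 2 = E" using False beta by (auto simp: s_def)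
  have "2 * E \<le> 12 * \<beta>" using E_le_6 beta by simp
  then have "2 * E / \<beta> \<le> 4\<^sup>2" using beta by (simp add: field_simps)
  then have s4: "s \<le> 4" unfolding s_def by (intro real_le_lsqrt) auto
  \<comment> \<open>If the energy exceeds the central hump, the inner turning point disappears and
    \<open>a\<close> is clipped to 0.\<close>
  define a where "a = sqrt (max 0 (1 - s))"
  define b where "b = sqrt (1 + s)"
  have ab: "0 \<le> a" "a \<le> b" using s by (auto simp: a_def b_def)
  have b3: "b \<le> 3" unfolding b_def using s4 by (intro real_le_lsqrt) auto
  have sq: "a\<^sup>2 = max 0 (1 - s)" "b\<^sup>2 = 1 + s" using s by (auto simp: a_def b_def)
  have W_ge: "E \<le> \<beta> * double_well x" if "s \<le> \<bar>x\<^sup>2 - 1\<bar>" for x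
  proof -
    have "s\<^sup>2 \<le> (x\<^sup>2 - 1)\<^sup>2" using power_mono[OF that s, of 2] by simp
    then have "\<beta> * s\<^sup>2 \<le> \<beta> * (x\<^sup>2 - 1)\<^sup>2" using beta by simp
    then show ?thesis using s2 by (simp add: double_well_def)
  qed
  have W_le: "\<beta> * double_well x \<le> E" if "\<bar>x\<^sup>2 - 1\<bar> \<le> s" for x
  proof -
    have "(x\<^sup>2 - 1)\<^sup>2 \<le> s\<^sup>2" using power_mono[OF that, of 2] by simp
    then have "\<beta> * (x\<^sup>2 - 1)\<^sup>2 \<le> \<beta> * s\<^sup>2" using beta by simp
    then show ?thesis using s2 by (simp add: double_well_def)
  qed
  have left: "f' x \<ge> 0" if x: "0 \<le> x" "x \<le> a" for x
  proof (cases "s \<le> 1")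
    case True
    have "f' 0 \<le> f' x"
    proof (rule mono_by_derivative[OF x(1) f'_deriv])
      fix y assume y: "0 \<le> y" "y \<le> x"
      then have "y\<^sup>2 \<le> a\<^sup>2" using x by (intro power_mono) auto
      then have "E \<le> \<beta> * double_well y" using True sq by (intro W_ge) auto
      then show "0 \<le> 2 * \<beta> * (\<beta> * double_well y - E) * f y"
        using beta f_nonneg[of y] y by simp
    qed
    then show ?thesis by (simp add: f'_0)
  next
    case False
    then have "x = 0" using x by (simp add: a_def)
    then show ?thesis by (simp add: f'_0)
  qed
  have right: "f' x \<le> 0" if "b \<le> x" for x
  proof (rule f'_nonpos[OF _ _ that])
    show "E \<le> \<beta> * double_well y" if "b \<le> y" for y
      using power_mono[OF that, of 2] ab sq by (intro W_ge) auto
  qed (use ab in simp)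
  have middle: "f' y \<le> f' x" if xy: "a \<le> x" "x \<le> y" "y \<le> b" for x y
  proof -
    have "- f' x \<le> - f' y"
    proof (rule mono_by_derivative[OF xy(2) DERIV_minus[OF f'_deriv]])
      fix z assume z: "x \<le> z" "z \<le> y"
      have "a\<^sup>2 \<le> z\<^sup>2" "z\<^sup>2 \<le> b\<^sup>2" using z xy ab by (auto intro!: power_mono)
      then have "\<beta> * double_well z \<le> E" using sq by (intro W_le) auto
      then have "2 * \<beta> * (\<beta> * double_well z - E) * f z \<le> 0"
        using beta f_nonneg[of z] z xy ab by (intro mult_nonpos_nonneg mult_nonneg_nonpos) auto
      then show "0 \<le> - (2 * \<beta> * (\<beta> * double_well z - E) * f z)" by simp
    qed (use xy ab in auto)
    then show ?thesis by simp
  qed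
  have "continuous_on {a..b} f'"
    using ab by (auto intro!: continuous_at_imp_continuous_on DERIV_isCont[OF f'_deriv])
  \<comment> \<open>Between the turning points \<open>f'\<close> is nonincreasing and changes sign,
    so any zero there separates the two monotone pieces.\<close>
  then obtain m where m: "a \<le> m" "m \<le> b" "f' m = 0"
    using IVT2'[of f' b 0 a] left[of a] right[of b] ab by auto
  show ?thesis
  proof (rule that[of m])
    show "f' x \<ge> 0" if "0 \<le> x" "x \<le> m" for x
      using left[of x] middle[of x m] that m by (cases "x \<le> a") auto
    show "f' x \<le> 0" if "m \<le> x" for x
      using right[of x] middle[of m x] that m by (cases "x \<le> b") auto
  qed (use m ab b3 in auto)
qed

definition mode :: real where
  "mode = (SOME m. 0 \<le> m \<and> m \<le> 3 \<and> (\<forall>x. 0 \<le> x \<longrightarrow> x \<le> m \<longrightarrow> f' x \<ge> 0)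
     \<and> (\<forall>x. m \<le> x \<longrightarrow> f' x \<le> 0))"

lemma mode: "0 \<le> mode" "mode \<le> 3"
    "0 \<le> x \<Longrightarrow> x \<le> mode \<Longrightarrow> f' x \<ge> 0" "mode \<le> x \<Longrightarrow> f' x \<le> 0"
proof -
  have "0 \<le> mode \<and> mode \<le> 3 \<and> (\<forall>x. 0 \<le> x \<longrightarrow> x \<le> mode \<longrightarrow> f' x \<ge> 0)
     \<and> (\<forall>x. mode \<le> x \<longrightarrow> f' x \<le> 0)"
    unfolding mode_def by (rule someI_ex) (metis unimodal)
  then show "0 \<le> mode" "mode \<le> 3"
    "0 \<le> x \<Longrightarrow> x \<le> mode \<Longrightarrow> f' x \<ge> 0" "mode \<le> x \<Longrightarrow> f' x \<le> 0" by auto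
qed

lemma mono_left: "0 \<le> x \<Longrightarrow> x \<le> y \<Longrightarrow> y \<le> mode \<Longrightarrow> f x \<le> f y"
  by (rule mono_by_derivative[OF _ f_deriv mode(3)]) auto

lemma antimono_right: "mode \<le> x \<Longrightarrow> x \<le> y \<Longrightarrow> f y \<le> f x"
  by (rule DERIV_nonpos_imp_nonincreasing[of x y f])
    (use mode in \<open>auto intro!: exI[of _ "f' _"] f_deriv\<close>)

lemma le_max: "0 \<le> x \<Longrightarrow> f x \<le> f mode"
  using mono_left[of x mode] antimono_right[of mode x] by (cases "x \<le> mode") auto

text \<open>
  Since \<open>f'' \<ge> - 12 \<beta> f mode\<close>, the function stays above half of its maximum on an interval of length
  of order \<open>\<beta>\<^bsup>-1/2\<^esup>\<close>; normalisation then bounds the maximum.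
\<close>

lemma f2_le:
  assumes "x \<ge> 0"
  shows "(f x)\<^sup>2 \<le> 10 * sqrt \<beta>"
proof -
  define M where "M = f mode"
  have M: "M > 0" using pos[OF mode(1)] by (simp add: M_def)
  \<comment> \<open>With this \<open>r\<close> the drop of \<open>f\<close> over the interval, at
    most \<open>12 * \<beta> * M * r\<^sup>2\<close>, is exactly \<open>M / 2\<close>.\<close>
  define r where "r = 1 / sqrt (24 * \<beta>)"
  have r: "r > 0" "24 * \<beta> * r\<^sup>2 = 1" using beta by (auto simp: r_def power_divide)
  have f'_lower: "- (12 * \<beta> * M * r) \<le> f' y" if y: "mode \<le> y" "y \<le> mode + r" for y
  proof -
    have "- f' y - (- f' mode) \<le> (12 * \<beta> * M) * (y - mode)"
    proof (rule increment_le_by_derivative[OF y(1) DERIV_minus[OF f'_deriv]])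
      fix z assume z: "mode \<le> z" "z \<le> y"
      then have z0: "z \<ge> 0" using mode by simp
      have "0 \<le> \<beta> * double_well z" using beta by (simp add: double_well_def)
      then have "2 * \<beta> * (E - \<beta> * double_well z) \<le> 2 * \<beta> * 6"
        using E_le_6 beta by (intro mult_left_mono) auto
      then have "2 * \<beta> * (E - \<beta> * double_well z) * f z \<le> 2 * \<beta> * 6 * f z"
        using f_nonneg[OF z0] by (intro mult_right_mono) auto
      also have "\<dots> \<le> 2 * \<beta> * 6 * M"
        using le_max[OF z0] beta by (intro mult_left_mono) (auto simp: M_def)
      finally show "- (2 * \<beta> * (\<beta> * double_well z - E) * f z) \<le> 12 * \<beta> * M"
        by (simp add: algebra_simps)
    qed (use mode in auto)
    moreover have "12 * \<beta> * M * (y - mode) \<le> 12 * \<beta> * M * r"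
      using y M beta by (intro mult_left_mono) auto
    ultimately show ?thesis using mode(3)[of mode] mode(1) by simp
  qed
  have f_lower: "M / 2 \<le> f y" if y: "mode \<le> y" "y \<le> mode + r" for y
  proof -
    have "- f y - (- f mode) \<le> (12 * \<beta> * M * r) * (y - mode)"
    proof (rule increment_le_by_derivative[OF y(1) DERIV_minus[OF f_deriv]])
      show "- f' z \<le> 12 * \<beta> * M * r" if "mode \<le> z" "z \<le> y" for z
        using f'_lower[of z] that y by simp
    qed (use mode in auto)
    also have "\<dots> \<le> (12 * \<beta> * M * r) * r"
      using y M beta r by (intro mult_left_mono) auto
    also have "\<dots> = M / 2 * (24 * \<beta> * r\<^sup>2)" by (simp add: power2_eq_square)
    finally show ?thesis using r by (simp add: M_def)
  qed
  have "T (mode + r) - T mode \<le> - (M / 2)\<^sup>2 * (mode + r - mode)"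
  proof (rule increment_le_by_derivative)
    show "- (f y)\<^sup>2 \<le> - (M / 2)\<^sup>2" if "mode \<le> y" "y \<le> mode + r" for y
      using f_lower[OF that] M by (auto intro!: power_mono)
  qed (use r mode in \<open>auto intro!: T_deriv\<close>)
  then have "M\<^sup>2 * r / 4 \<le> 1 / 2"
    using T_nonneg[of "mode + r"] T_le_half[of mode] mode(1) r by (simp add: power_divide mult.commute)
  then have "M\<^sup>2 \<le> 2 / r" using r by (simp add: field_simps)
  also have "\<dots> = 2 * sqrt 24 * sqrt \<beta>" by (simp add: r_def real_sqrt_mult)
  also have "\<dots> \<le> 2 * 5 * sqrt \<beta>"
    using beta by (intro mult_right_mono mult_left_mono real_le_lsqrt) auto
  finally have "M\<^sup>2 \<le> 10 * sqrt \<beta>" by simp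
  moreover have "(f x)\<^sup>2 \<le> M\<^sup>2"
    using le_max[OF assms] f_nonneg[OF assms] by (auto simp: M_def intro!: power_mono)
  ultimately show ?thesis by simp
qed

text \<open>Up to 3 the density is at most \<open>(f x)\<^sup>2\<close> on a length of at most 3;
  \<open>T_le_f2\<close> adds 1/2 for the rest, giving 7/2.\<close>

lemma T_le_f2_right:
  assumes "mode \<le> x" "x \<le> 3"
  shows "T x \<le> 7 / 2 * (f x)\<^sup>2"
proof -
  have sq: "(f y)\<^sup>2 \<le> (f x)\<^sup>2" if "x \<le> y" for y
    using antimono_right[of x y] f_nonneg[of y] assms that mode by (auto intro!: power_mono)
  have "- T 3 - (- T x) \<le> (f x)\<^sup>2 * (3 - x)"
  proof (rule increment_le_by_derivative[OF assms(2) DERIV_minus[OF T_deriv]])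
    show "- (- (f y)\<^sup>2) \<le> (f x)\<^sup>2" if "x \<le> y" for y using sq[OF that] by simp
  qed (use assms mode in auto)
  moreover have "(f x)\<^sup>2 * (3 - x) \<le> (f x)\<^sup>2 * 3" using assms mode by (intro mult_left_mono) auto
  ultimately show ?thesis using T_le_f2[of 3] sq[of 3] assms by simp
qed

end

subsection \<open>The ratio of the first two eigenfunctions\<close>

locale half_line_pair =
  s0: half_line_ground_state \<beta> E0 f0 f0' T0 + s1: half_line_state \<beta> E1 f1 f1' T1
  for \<beta> E0 E1 :: real and f0 f0' T0 f1 f1' T1 :: "real \<Rightarrow> real" +
  assumes E_less: "E0 < E1"
begin

abbreviation "\<delta> \<equiv> E1 - E0"

definition \<phi> :: "real \<Rightarrow> real" where
  "\<phi> x = f1 x / f0 x"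

text \<open>The Wronskian, scaled such that it is the tail integral of \<open>f0 * f1\<close>.\<close>

definition S :: "real \<Rightarrow> real" where
  "S x = (f1' x * f0 x - f1 x * f0' x) / (2 * \<beta> * \<delta>)"

lemma beta: "\<beta> \<ge> 1" by (rule s0.beta)

lemma delta_pos: "\<delta> > 0" using E_less by simp

text \<open>In the Wronskian derivative the potential cancels and only the energy difference
  survives, which the scaling in \<open>S\<close> removes.\<close>

lemma S_deriv:
  assumes "x \<ge> 0"
  shows "(S has_real_derivative - (f0 x * f1 x)) (at x)"
proof -
  have "((\<lambda>x. f1' x * f0 x - f1 x * f0' x) has_real_derivative
      2 * \<beta> * \<delta> * - (f0 x * f1 x)) (at x)"
    using assms by (auto intro!: derivative_eq_intros s0.f_deriv s0.f'_deriv s1.f_deriv s1.f'_deriv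
        simp: algebra_simps)
  from DERIV_cdivide[OF this, of "2 * \<beta> * \<delta>"] show ?thesis
    unfolding S_def[abs_def] using beta delta_pos by simp
qed

lemma S_lim: "(S \<longlongrightarrow> 0) at_top"
proof -
  have "((\<lambda>x. f0' x * f1 x) \<longlongrightarrow> 0) at_top"
  proof (rule Lim_null_comparison[where g = "\<lambda>x. - f0' 3 * f1 x"])
    have "norm (f0' x * f1 x) \<le> - f0' 3 * f1 x" if "x \<ge> 3" for x
      using that s0.f'_ge[of x] s0.f'_nonpos_3[of x] s1.f_nonneg[of x]
      by (auto simp: abs_mult intro!: mult_right_mono)
    then show "\<forall>\<^sub>F x in at_top. norm (f0' x * f1 x) \<le> - f0' 3 * f1 x"
      by (auto simp: eventually_at_top_linorder)
    show "((\<lambda>x. - f0' 3 * f1 x) \<longlongrightarrow> 0) at_top"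
      by (rule tendsto_mult_right_zero[OF s1.f_lim])
  qed
  moreover have "((\<lambda>x. f1' x * f0 x) \<longlongrightarrow> 0) at_top"
  proof (rule Lim_null_comparison[where g = "\<lambda>x. - f1' 3 * f0 x"])
    have "norm (f1' x * f0 x) \<le> - f1' 3 * f0 x" if "x \<ge> 3" for x
      using that s1.f'_ge[of x] s1.f'_nonpos_3[of x] s0.f_nonneg[of x]
      by (auto simp: abs_mult intro!: mult_right_mono)
    then show "\<forall>\<^sub>F x in at_top. norm (f1' x * f0 x) \<le> - f1' 3 * f0 x"
      by (auto simp: eventually_at_top_linorder)
    show "((\<lambda>x. - f1' 3 * f0 x) \<longlongrightarrow> 0) at_top"
      by (rule tendsto_mult_right_zero[OF s0.f_lim])
  qed
  ultimately have "((\<lambda>x. (f1' x * f0 x - f0' x * f1 x) / (2 * \<beta> * \<delta>)) \<longlongrightarrow> 0) at_top"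
    using tendsto_divide_zero[where c = "2 * \<beta> * \<delta>"] tendsto_diff by fastforce
  then show ?thesis by (simp add: S_def[abs_def] mult.commute)
qed

lemma S_nonneg: "x \<ge> 0 \<Longrightarrow> S x \<ge> 0"
  by (rule nonneg_of_antitone_tendsto_0[of 0 S, OF S_deriv _ S_lim])
    (auto intro!: mult_nonneg_nonneg s0.f_nonneg s1.f_nonneg)

text \<open>The expression is the tail integral of \<open>(t * f0 - f1)\<^sup>2\<close>.\<close>

lemma quadratic_nonneg:
  assumes "x \<ge> 0"
  shows "0 \<le> t\<^sup>2 * T0 x - 2 * t * S x + T1 x"
proof (rule nonneg_of_antitone_tendsto_0[of 0 "\<lambda>x. t\<^sup>2 * T0 x - 2 * t * S x + T1 x"])
  fix y :: real assume y: "y \<ge> 0"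
  show "((\<lambda>x. t\<^sup>2 * T0 x - 2 * t * S x + T1 x) has_real_derivative - (t * f0 y - f1 y)\<^sup>2) (at y)"
    using y by (auto intro!: derivative_eq_intros s0.T_deriv s1.T_deriv S_deriv
        simp: power2_eq_square algebra_simps)
qed (use assms in \<open>auto intro!: tendsto_eq_intros s0.T_lim s1.T_lim S_lim\<close>)

lemma S_le_half: "x \<ge> 0 \<Longrightarrow> S x \<le> 1 / 2"
  using quadratic_nonneg[of x 1] s0.T_le_half[of x] s1.T_le_half[of x] by simp

text \<open>Cauchy-Schwarz for tail integrals, obtained from the minimiser
  \<open>t = S x / T0 x\<close> of the quadratic.\<close>

lemma S2_le:
  assumes "x \<ge> 0"
  shows "(S x)\<^sup>2 \<le> T0 x * T1 x"
proof -
  have "T0 x > 0" using s0.T_pos[OF assms] .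
  have "0 \<le> T0 x * ((S x / T0 x)\<^sup>2 * T0 x - 2 * (S x / T0 x) * S x + T1 x)"
    using quadratic_nonneg[OF assms, of "S x / T0 x"] \<open>T0 x > 0\<close>
    by (intro mult_nonneg_nonneg) auto
  also have "\<dots> = T0 x * T1 x - (S x)\<^sup>2"
    using \<open>T0 x > 0\<close> by (simp add: power2_eq_square field_simps)
  finally show ?thesis by simp
qed

text \<open>Beyond 3 both factors decay at least at unit rate, so
  \<open>(f0 * f1)' \<le> - 2 * f0 * f1\<close>; hence the factor 1/2.\<close>

lemma S_le_tail:
  assumes "x \<ge> 3"
  shows "S x \<le> f0 x * f1 x / 2"
proof -
  have "0 \<le> f0 x * f1 x / 2 - S x"
  proof (rule nonneg_of_antitone_tendsto_0[of 3 "\<lambda>x. f0 x * f1 x / 2 - S x"])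
    fix y :: real assume y: "y \<ge> 3"
    show "((\<lambda>x. f0 x * f1 x / 2 - S x) has_real_derivative
        (f0' y + f0 y) * f1 y / 2 + f0 y * (f1' y + f1 y) / 2) (at y)"
      using y by (auto intro!: derivative_eq_intros s0.f_deriv s1.f_deriv S_deriv
          simp: field_simps)
    have "(f0' y + f0 y) * f1 y \<le> 0"
      using s0.f'_le_neg_f[OF y] s1.f_nonneg[of y] y by (intro mult_nonpos_nonneg) auto
    moreover have "f0 y * (f1' y + f1 y) \<le> 0"
      using s1.f'_le_neg_f[OF y] s0.f_nonneg[of y] y by (intro mult_nonneg_nonpos) auto
    ultimately show "(f0' y + f0 y) * f1 y / 2 + f0 y * (f1' y + f1 y) / 2 \<le> 0" by simp
  qed (use assms in \<open>auto intro!: tendsto_eq_intros s0.f_lim s1.f_lim S_lim\<close>)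
  then show ?thesis by simp
qed

section \<open>Monotonicity and growth of the ratio\<close>

lemma phi_nonneg: "x \<ge> 0 \<Longrightarrow> \<phi> x \<ge> 0"
  unfolding \<phi>_def using s0.pos[of x] s1.f_nonneg[of x] by simp

abbreviation "\<phi>' x \<equiv> 2 * \<beta> * \<delta> * S x / (f0 x)\<^sup>2"

lemma phi_deriv:
  assumes "x \<ge> 0"
  shows "(\<phi> has_real_derivative \<phi>' x) (at x)"
proof -
  have "f0 x \<noteq> 0" using s0.pos[OF assms] by simp
  then show ?thesis
    unfolding \<phi>_def[abs_def] using assms beta delta_pos
    by (auto intro!: derivative_eq_intros s0.f_deriv s1.f_deriv simp: S_def power2_eq_square)
qed

lemma phi'_nonneg: "x \<ge> 0 \<Longrightarrow> \<phi>' x \<ge> 0"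
  using S_nonneg[of x] beta delta_pos by simp

lemma phi_mono: "0 \<le> x \<Longrightarrow> x \<le> y \<Longrightarrow> \<phi> x \<le> \<phi> y"
  by (rule mono_by_derivative[OF _ phi_deriv phi'_nonneg]) auto

lemma f1_eq: "x \<ge> 0 \<Longrightarrow> f1 x = \<phi> x * f0 x"
  using s0.pos[of x] by (simp add: \<phi>_def)

text \<open>Monotonicity does not bound \<open>\<phi>\<close>, but \<open>T_le_f2\<close> trades
  \<open>T0\<close> for \<open>f0\<^sup>2\<close>, which absorbs the denominator of
  \<open>\<phi>\<close>.\<close>

lemma phi_T0_lim: "((\<lambda>x. \<phi> x * T0 x) \<longlongrightarrow> 0) at_top"
proof (rule tendsto_sandwich[where f = "\<lambda>_. 0" and h = "\<lambda>x. f0 x * f1 x / 2"])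
  have "0 \<le> \<phi> x * T0 x \<and> \<phi> x * T0 x \<le> f0 x * f1 x / 2" if "x \<ge> 3" for x
  proof -
    have "\<phi> x * T0 x \<le> \<phi> x * ((f0 x)\<^sup>2 / 2)"
      using s0.T_le_f2[OF that] phi_nonneg[of x] that by (intro mult_left_mono) auto
    then show ?thesis
      using that phi_nonneg[of x] s0.T_nonneg[of x] f1_eq[of x]
      by (simp add: power2_eq_square mult_ac)
  qed
  then show "\<forall>\<^sub>F x in at_top. 0 \<le> \<phi> x * T0 x" "\<forall>\<^sub>F x in at_top. \<phi> x * T0 x \<le> f0 x * f1 x / 2"
    by (auto simp: eventually_at_top_linorder)
qed (auto intro!: tendsto_eq_intros s0.f_lim s1.f_lim)

lemma phi2_T0_lim: "((\<lambda>x. (\<phi> x)\<^sup>2 * T0 x) \<longlongrightarrow> 0) at_top"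
proof (rule tendsto_sandwich[where f = "\<lambda>_. 0" and h = "\<lambda>x. (f1 x)\<^sup>2 / 2"])
  have "0 \<le> (\<phi> x)\<^sup>2 * T0 x \<and> (\<phi> x)\<^sup>2 * T0 x \<le> (f1 x)\<^sup>2 / 2" if "x \<ge> 3" for x
  proof -
    have "(\<phi> x)\<^sup>2 * T0 x \<le> (\<phi> x)\<^sup>2 * ((f0 x)\<^sup>2 / 2)"
      using s0.T_le_f2[OF that] by (intro mult_left_mono) auto
    then show ?thesis
      using that s0.T_nonneg[of x] f1_eq[of x] by (simp add: power_mult_distrib)
  qed
  then show "\<forall>\<^sub>F x in at_top. 0 \<le> (\<phi> x)\<^sup>2 * T0 x" "\<forall>\<^sub>F x in at_top. (\<phi> x)\<^sup>2 * T0 x \<le> (f1 x)\<^sup>2 / 2"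
    by (auto simp: eventually_at_top_linorder)
qed (auto intro!: tendsto_eq_intros s1.f_lim)

text \<open>\<open>S\<close> is the tail integral of \<open>\<phi> * f0\<^sup>2\<close>, and on the
  tail the increasing \<open>\<phi>\<close> is at least its value at \<open>x\<close>.\<close>

lemma phi_T0_le_S:
  assumes "x \<ge> 0"
  shows "\<phi> x * T0 x \<le> S x"
proof -
  have "0 \<le> S x - \<phi> x * T0 x"
  proof (rule nonneg_of_antitone_tendsto_0[of 0 "\<lambda>x. S x - \<phi> x * T0 x"])
    fix y :: real assume y: "y \<ge> 0"
    have "((\<lambda>x. S x - \<phi> x * T0 x) has_real_derivative
        - (f0 y * f1 y) - (\<phi>' y * T0 y + - (f0 y)\<^sup>2 * \<phi> y)) (at y)"
      using y by (intro DERIV_diff DERIV_mult S_deriv phi_deriv s0.T_deriv)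
    moreover have "- (f0 y * f1 y) - (\<phi>' y * T0 y + - (f0 y)\<^sup>2 * \<phi> y) = - (\<phi>' y * T0 y)"
      using f1_eq[OF y] by (simp add: power2_eq_square)
    ultimately show "((\<lambda>x. S x - \<phi> x * T0 x) has_real_derivative - (\<phi>' y * T0 y)) (at y)"
      by simp
    show "- (\<phi>' y * T0 y) \<le> 0"
      using mult_nonneg_nonneg[OF phi'_nonneg[OF y] s0.T_nonneg[OF y]] by simp
  qed (use assms tendsto_diff[OF S_lim phi_T0_lim] in auto)
  then show ?thesis by simp
qed

text \<open>
  The function \<open>A\<close> equals the integral of \<open>2 * \<phi> * \<phi>' * T0\<close> over the tail, while the normalisations and
  monotonicity of \<open>\<phi>\<close> give \<open>(1 - \<phi>\<^sup>2) / 2 \<le> A\<close>.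
\<close>

definition A :: "real \<Rightarrow> real" where
  "A x = T1 x - (\<phi> x)\<^sup>2 * T0 x"

lemma A_ge:
  assumes "x \<ge> 0"
  shows "(1 - (\<phi> x)\<^sup>2) / 2 \<le> A x"
proof -
  \<comment> \<open>The coefficient is frozen at its value at \<open>x\<close> while the arguments
    of \<open>T0\<close> and \<open>T1\<close> move from 0 to \<open>x\<close>.\<close>
  have "T1 0 - (\<phi> x)\<^sup>2 * T0 0 \<le> T1 x - (\<phi> x)\<^sup>2 * T0 x"
  proof (rule mono_by_derivative[OF assms])
    fix y assume y: "0 \<le> y" "y \<le> x"
    show "((\<lambda>y. T1 y - (\<phi> x)\<^sup>2 * T0 y) has_real_derivative
        (\<phi> x)\<^sup>2 * (f0 y)\<^sup>2 - (f1 y)\<^sup>2) (at y)"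
      using y by (auto intro!: derivative_eq_intros s0.T_deriv s1.T_deriv)
    have "(\<phi> y)\<^sup>2 \<le> (\<phi> x)\<^sup>2" using phi_mono[OF y] phi_nonneg[OF y(1)] by (intro power_mono)
    then show "0 \<le> (\<phi> x)\<^sup>2 * (f0 y)\<^sup>2 - (f1 y)\<^sup>2"
      using f1_eq[OF y(1)] by (simp add: power_mult_distrib mult_right_mono)
  qed
  then show ?thesis by (simp add: A_def s0.T_0 s1.T_0 field_simps)
qed

lemma A_deriv:
  assumes "x \<ge> 0"
  shows "(A has_real_derivative - (2 * (\<phi> x * T0 x) * \<phi>' x)) (at x)"
proof -
  have "(A has_real_derivative
      - (f1 x)\<^sup>2 - (2 * (\<phi>' x * \<phi> x) * T0 x + - (f0 x)\<^sup>2 * (\<phi> x)\<^sup>2)) (at x)"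
    unfolding A_def[abs_def]
    using DERIV_power[OF phi_deriv[OF assms], of 2] assms
    by (intro DERIV_diff DERIV_mult s1.T_deriv s0.T_deriv) auto
  then show ?thesis using f1_eq[OF assms] by (simp add: power_mult_distrib algebra_simps)
qed

text \<open>This reduces all estimates of \<open>A\<close> to bounds on \<open>S\<close> relative to
  \<open>f0\<close>, with the factor \<open>\<beta> * \<delta>\<close> split off.\<close>

lemma A_deriv_bound:
  assumes "x \<ge> 0"
  shows "2 * (\<phi> x * T0 x) * \<phi>' x \<le> 4 * \<beta> * \<delta> * (S x)\<^sup>2 / (f0 x)\<^sup>2"
proof -
  have "2 * (\<phi> x * T0 x) * \<phi>' x \<le> 2 * S x * \<phi>' x"
    using phi_T0_le_S[OF assms] phi'_nonneg[OF assms] by (intro mult_right_mono) auto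
  also have "\<dots> = 4 * \<beta> * \<delta> * (S x)\<^sup>2 / (f0 x)\<^sup>2" by (simp add: power2_eq_square)
  finally show ?thesis .
qed

text \<open>Here \<open>S_le_tail\<close> cancels \<open>f0\<close> and leaves
  \<open>- A' \<le> \<beta> * \<delta> * f1\<^sup>2\<close>, which integrates to
  \<open>\<beta> * \<delta> * T1\<close>.\<close>

lemma A_le_tail:
  assumes "x \<ge> 3"
  shows "A x \<le> \<beta> * \<delta> / 2"
proof -
  have "0 \<le> \<beta> * \<delta> * T1 x - A x"
  proof (rule nonneg_of_antitone_tendsto_0[of 3 "\<lambda>x. \<beta> * \<delta> * T1 x - A x"])
    fix y :: real assume y: "y \<ge> 3"
    show "((\<lambda>x. \<beta> * \<delta> * T1 x - A x) has_real_derivative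
        \<beta> * \<delta> * - (f1 y)\<^sup>2 - - (2 * (\<phi> y * T0 y) * \<phi>' y)) (at y)"
      using y by (intro DERIV_diff DERIV_cmult s1.T_deriv A_deriv) auto
    have "(S y)\<^sup>2 \<le> (f0 y * f1 y / 2)\<^sup>2"
      using S_le_tail[OF y] S_nonneg[of y] y by (intro power_mono) auto
    then have "4 * \<beta> * \<delta> * (S y)\<^sup>2 \<le> 4 * \<beta> * \<delta> * (f0 y * f1 y / 2)\<^sup>2"
      using beta delta_pos by (intro mult_left_mono) auto
    also have "\<dots> = \<beta> * \<delta> * (f1 y)\<^sup>2 * (f0 y)\<^sup>2" by (simp add: power2_eq_square)
    finally have "4 * \<beta> * \<delta> * (S y)\<^sup>2 / (f0 y)\<^sup>2 \<le> \<beta> * \<delta> * (f1 y)\<^sup>2"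
      using s0.pos[of y] y by (simp add: divide_le_eq)
    then show "\<beta> * \<delta> * - (f1 y)\<^sup>2 - - (2 * (\<phi> y * T0 y) * \<phi>' y) \<le> 0"
      using A_deriv_bound[of y] y by simp
  next
    have "(A \<longlongrightarrow> 0) at_top"
      unfolding A_def[abs_def] using tendsto_diff[OF s1.T_lim phi2_T0_lim] by simp
    then show "((\<lambda>x. \<beta> * \<delta> * T1 x - A x) \<longlongrightarrow> 0) at_top"
      by (auto intro!: tendsto_eq_intros s1.T_lim)
  qed (use assms in auto)
  moreover have "\<beta> * \<delta> * T1 x \<le> \<beta> * \<delta> * (1 / 2)"
    using s1.T_le_half[of x] assms beta delta_pos by (intro mult_left_mono) auto
  ultimately show ?thesis by simp
qed

text \<open>Between the mode and 3, \<open>S2_le\<close> and \<open>T_le_f2_right\<close> bound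
  \<open>- A'\<close> by \<open>7 * \<beta> * \<delta>\<close>. Length at most 3 and the tail give
  21 + 1/2, rounded to 22.\<close>

lemma A_le_right:
  assumes "s0.mode \<le> x"
  shows "A x \<le> 22 * \<beta> * \<delta>"
proof (cases "x \<le> 3")
  case True
  have x0: "x \<ge> 0" using s0.mode assms by simp
  have "- A 3 - (- A x) \<le> 7 * \<beta> * \<delta> * (3 - x)"
  proof (rule increment_le_by_derivative[OF True DERIV_minus[OF A_deriv]])
    fix y assume y: "x \<le> y" "y \<le> 3"
    then have y0: "y \<ge> 0" using x0 by simp
    have "T0 y * T1 y \<le> (7 / 2 * (f0 y)\<^sup>2) * (1 / 2)"
      using s0.T_le_f2_right[of y] s1.T_le_half[OF y0] s1.T_nonneg[OF y0] y assms
      by (intro mult_mono) auto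
    then have "(S y)\<^sup>2 \<le> 7 / 4 * (f0 y)\<^sup>2" using S2_le[OF y0] by simp
    then have "4 * \<beta> * \<delta> * (S y)\<^sup>2 \<le> 4 * \<beta> * \<delta> * (7 / 4 * (f0 y)\<^sup>2)"
      using beta delta_pos by (intro mult_left_mono) auto
    then have "4 * \<beta> * \<delta> * (S y)\<^sup>2 / (f0 y)\<^sup>2 \<le> 7 * \<beta> * \<delta>"
      using s0.pos[OF y0] by (simp add: divide_le_eq)
    then show "- (- (2 * (\<phi> y * T0 y) * \<phi>' y)) \<le> 7 * \<beta> * \<delta>"
      using A_deriv_bound[OF y0] by simp
  qed (use x0 in auto)
  also have "\<dots> \<le> 7 * \<beta> * \<delta> * 3" using x0 beta delta_pos by (intro mult_left_mono) auto
  finally have "A x \<le> 21 * (\<beta> * \<delta>) + A 3" by simp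
  moreover have "\<beta> * \<delta> > 0" using beta delta_pos by simp
  ultimately show ?thesis using A_le_tail[of 3] by simp
next
  case False
  moreover have "\<beta> * \<delta> > 0" using beta delta_pos by simp
  ultimately show ?thesis using A_le_tail[of x] by simp
qed

text \<open>Left of the mode only \<open>S \<le> 1 / 2\<close> is used; since \<open>f0\<close>
  increases there, \<open>1 / (f0 y)\<^sup>2\<close> is at most \<open>1 / (f0 x)\<^sup>2\<close>,
  which the weight cancels. The constant is 10 * 22 + 3.\<close>

lemma f0_A_le:
  assumes "x \<ge> 0"
  shows "(f0 x)\<^sup>2 * A x \<le> 223 * \<beta> * sqrt \<beta> * \<delta>"
proof -
  have bd: "\<beta> * \<delta> > 0" using beta delta_pos by simp
  have right: "(f0 x)\<^sup>2 * (22 * \<beta> * \<delta>) \<le> 10 * sqrt \<beta> * (22 * \<beta> * \<delta>)"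
    using s0.f2_le[OF assms] bd by (intro mult_right_mono) auto
  have "\<beta> * \<delta> * 1 \<le> \<beta> * \<delta> * sqrt \<beta>" using bd beta by (intro mult_left_mono) auto
  moreover have "(f0 x)\<^sup>2 * A x \<le> (f0 x)\<^sup>2 * (22 * \<beta> * \<delta>) + 3 * (\<beta> * \<delta>)"
  proof (cases "s0.mode \<le> x")
    case True
    then have "(f0 x)\<^sup>2 * A x \<le> (f0 x)\<^sup>2 * (22 * \<beta> * \<delta>)"
      using A_le_right by (intro mult_left_mono) auto
    then show ?thesis using bd by simp
  next
    case False
    then have x: "x \<le> s0.mode" by simp
    have "- A s0.mode - (- A x) \<le> \<beta> * \<delta> / (f0 x)\<^sup>2 * (s0.mode - x)"
    proof (rule increment_le_by_derivative[OF x DERIV_minus[OF A_deriv]])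
      fix y assume y: "x \<le> y" "y \<le> s0.mode"
      then have y0: "y \<ge> 0" using assms by simp
      have "(S y)\<^sup>2 \<le> (1 / 2)\<^sup>2" using S_le_half[OF y0] S_nonneg[OF y0] by (intro power_mono)
      then have "4 * \<beta> * \<delta> * (S y)\<^sup>2 \<le> 4 * \<beta> * \<delta> * (1 / 4)"
        using beta delta_pos by (intro mult_left_mono) (auto simp: power_divide)
      then have "4 * \<beta> * \<delta> * (S y)\<^sup>2 / (f0 y)\<^sup>2 \<le> \<beta> * \<delta> / (f0 x)\<^sup>2"
        using s0.mono_left[OF assms y] s0.pos[OF assms] bd
        by (intro frac_le) (auto intro!: power_mono)
      then show "- (- (2 * (\<phi> y * T0 y) * \<phi>' y)) \<le> \<beta> * \<delta> / (f0 x)\<^sup>2"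
        using A_deriv_bound[OF y0] by simp
    qed (use assms in auto)
    also have "\<dots> \<le> \<beta> * \<delta> / (f0 x)\<^sup>2 * 3"
      using bd s0.mode assms by (intro mult_left_mono) auto
    finally have "A x \<le> 22 * \<beta> * \<delta> + 3 * (\<beta> * \<delta>) / (f0 x)\<^sup>2"
      using A_le_right[of s0.mode] by (simp add: mult_ac)
    then have "(f0 x)\<^sup>2 * A x \<le> (f0 x)\<^sup>2 * (22 * \<beta> * \<delta> + 3 * (\<beta> * \<delta>) / (f0 x)\<^sup>2)"
      by (intro mult_left_mono) auto
    also have "\<dots> = (f0 x)\<^sup>2 * (22 * \<beta> * \<delta>) + 3 * (\<beta> * \<delta>)"
      using s0.pos[OF assms] by (simp add: field_simps)
    finally show ?thesis .
  qed
  ultimately show ?thesis using right by (simp add: algebra_simps)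
qed

text \<open>
  Dually, \<open>B\<close> equals the integral of \<open>\<phi>' * (1 / 2 - T0)\<close> from \<open>0\<close>, and \<open>(\<phi> - 1) / 2 \<le> B\<close> because
  \<open>S 0 \<le> 1 / 2\<close>.
\<close>

definition B :: "real \<Rightarrow> real" where
  "B x = \<phi> x * (1 / 2 - T0 x) - (S 0 - S x)"

text \<open>The difference of the two sides is
  \<open>(1 / 2 - S 0) + (S x - \<phi> x * T0 x)\<close>, a sum of nonnegative terms.\<close>

lemma B_ge: "x \<ge> 0 \<Longrightarrow> (\<phi> x - 1) / 2 \<le> B x"
  using phi_T0_le_S[of x] S_le_half[of 0] by (simp add: B_def field_simps)

lemma B_deriv:
  assumes "x \<ge> 0"
  shows "(B has_real_derivative \<phi>' x * (1 / 2 - T0 x)) (at x)"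
proof -
  have "(B has_real_derivative
      (\<phi>' x * (1 / 2 - T0 x) + (0 - - (f0 x)\<^sup>2) * \<phi> x) - (0 - - (f0 x * f1 x))) (at x)"
    unfolding B_def[abs_def]
    using assms by (intro DERIV_diff DERIV_mult DERIV_const phi_deriv s0.T_deriv S_deriv)
  then show ?thesis using f1_eq[OF assms] by (simp add: power2_eq_square)
qed

lemma phi'_le:
  assumes "x \<ge> 0"
  shows "\<phi>' x \<le> \<beta> * \<delta> / (f0 x)\<^sup>2"
proof -
  have "2 * \<beta> * \<delta> * S x \<le> 2 * \<beta> * \<delta> * (1 / 2)"
    using S_le_half[OF assms] beta delta_pos by (intro mult_left_mono) auto
  then show ?thesis by (intro divide_right_mono) auto
qed

text \<open>As \<open>f0\<close> increases up to the mode, the mass on \<open>[0, y]\<close> is at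
  most \<open>3 * (f0 y)\<^sup>2\<close>, cancelling the denominator of \<open>\<phi>'\<close>. The
  interval has length at most 3.\<close>

lemma B_le_left:
  assumes "0 \<le> x" "x \<le> s0.mode"
  shows "B x \<le> 9 * \<beta> * \<delta>"
proof -
  have bd: "\<beta> * \<delta> > 0" using beta delta_pos by simp
  have "B x - B 0 \<le> 3 * \<beta> * \<delta> * (x - 0)"
  proof (rule increment_le_by_derivative[OF assms(1) B_deriv])
    fix y assume y: "0 \<le> y" "y \<le> x"
    have "- T0 y - (- T0 0) \<le> (f0 y)\<^sup>2 * (y - 0)"
    proof (rule increment_le_by_derivative[OF y(1) DERIV_minus[OF s0.T_deriv]])
      show "- (- (f0 z)\<^sup>2) \<le> (f0 y)\<^sup>2" if "0 \<le> z" "z \<le> y" for z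
        using s0.mono_left[of z y] s0.f_nonneg[of z] that y assms by (auto intro!: power_mono)
    qed
    also have "\<dots> \<le> (f0 y)\<^sup>2 * 3" using y assms s0.mode by (intro mult_left_mono) auto
    finally have F: "1 / 2 - T0 y \<le> 3 * (f0 y)\<^sup>2" by (simp add: s0.T_0)
    have "\<phi>' y * (1 / 2 - T0 y) \<le> \<beta> * \<delta> / (f0 y)\<^sup>2 * (3 * (f0 y)\<^sup>2)"
      using F phi'_le[OF y(1)] s0.T_le_half[OF y(1)] bd by (intro mult_mono) auto
    also have "\<dots> = 3 * \<beta> * \<delta>" using s0.pos[OF y(1)] by simp
    finally show "\<phi>' y * (1 / 2 - T0 y) \<le> 3 * \<beta> * \<delta>" .
  qed
  also have "\<dots> \<le> 3 * \<beta> * \<delta> * 3" using assms s0.mode bd by (intro mult_left_mono) auto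
  finally show ?thesis by (simp add: B_def s0.T_0)
qed

lemma B_deriv_le:
  assumes "x \<ge> 0"
  shows "\<phi>' x * (1 / 2 - T0 x) \<le> \<beta> * \<delta> / 2 / (f0 x)\<^sup>2"
proof -
  have "\<phi>' x * (1 / 2 - T0 x) \<le> \<beta> * \<delta> / (f0 x)\<^sup>2 * (1 / 2)"
    using phi'_le[OF assms] s0.T_le_half[OF assms] s0.T_nonneg[OF assms] beta delta_pos
    by (intro mult_mono) auto
  then show ?thesis by simp
qed

text \<open>Right of the mode \<open>1 / f0\<^sup>2\<close> is largest at the endpoint
  \<open>x\<close>, so the mass factor is simply bounded by 1/2. The length is rounded up to
  4.\<close>

lemma B_le_middle:
  assumes "s0.mode \<le> x" "x \<le> 3"
  shows "B x \<le> 9 * \<beta> * \<delta> + 2 * \<beta> * \<delta> / (f0 x)\<^sup>2"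
proof -
  have bd: "\<beta> * \<delta> > 0" using beta delta_pos by simp
  have x0: "x \<ge> 0" using assms s0.mode by simp
  have "B x - B s0.mode \<le> \<beta> * \<delta> / 2 / (f0 x)\<^sup>2 * (x - s0.mode)"
  proof (rule increment_le_by_derivative[OF assms(1) B_deriv])
    fix y assume y: "s0.mode \<le> y" "y \<le> x"
    then have y0: "y \<ge> 0" using s0.mode by simp
    have "\<beta> * \<delta> / 2 / (f0 y)\<^sup>2 \<le> \<beta> * \<delta> / 2 / (f0 x)\<^sup>2"
      using s0.antimono_right[OF y] s0.pos[OF x0] bd
      by (intro divide_left_mono) (auto intro!: power_mono)
    then show "\<phi>' y * (1 / 2 - T0 y) \<le> \<beta> * \<delta> / 2 / (f0 x)\<^sup>2"
      using B_deriv_le[OF y0] by simp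
  qed (use s0.mode in auto)
  also have "\<dots> \<le> \<beta> * \<delta> / 2 / (f0 x)\<^sup>2 * 4"
    using bd assms s0.mode by (intro mult_left_mono) auto
  finally show ?thesis using B_le_left[of s0.mode] s0.mode by simp
qed

text \<open>A length factor would be unbounded here. Instead \<open>1 / f0\<^sup>2\<close> serves as
  a majorant: by \<open>f'_le_neg_f\<close> its derivative is at least
  \<open>2 / f0\<^sup>2\<close>, enough to dominate \<open>B'\<close>.\<close>

lemma B_le_tail:
  assumes "x \<ge> 3"
  shows "B x \<le> 9 * \<beta> * \<delta> + 2 * \<beta> * \<delta> / (f0 x)\<^sup>2"
proof -
  have bd: "\<beta> * \<delta> > 0" using beta delta_pos by simp
  have "2 * \<beta> * \<delta> * inverse ((f0 3)\<^sup>2) - B 3 \<le> 2 * \<beta> * \<delta> * inverse ((f0 x)\<^sup>2) - B x"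
  proof (rule mono_by_derivative[OF assms])
    fix y assume y: "3 \<le> y" "y \<le> x"
    then have y0: "y \<ge> 0" by simp
    have p: "f0 y > 0" using s0.pos[OF y0] .
    have "((\<lambda>y. inverse ((f0 y)\<^sup>2)) has_real_derivative - (2 * f0' y) / (f0 y) ^ 3) (at y)"
      using p y0 by (auto intro!: derivative_eq_intros s0.f_deriv
          simp: field_simps power2_eq_square power3_eq_cube)
    from DERIV_diff[OF DERIV_cmult[OF this, of "2 * \<beta> * \<delta>"] B_deriv[OF y0]]
    show "((\<lambda>y. 2 * \<beta> * \<delta> * inverse ((f0 y)\<^sup>2) - B y) has_real_derivative
        2 * \<beta> * \<delta> * (- (2 * f0' y) / (f0 y) ^ 3) - \<phi>' y * (1 / 2 - T0 y)) (at y)" .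
    have "2 / (f0 y)\<^sup>2 = 2 * f0 y / (f0 y) ^ 3"
      using p by (simp add: power2_eq_square power3_eq_cube)
    also have "\<dots> \<le> - (2 * f0' y) / (f0 y) ^ 3"
      using p s0.f'_le_neg_f[OF y(1)] by (intro divide_right_mono) auto
    finally have "2 * \<beta> * \<delta> * (2 / (f0 y)\<^sup>2) \<le> 2 * \<beta> * \<delta> * (- (2 * f0' y) / (f0 y) ^ 3)"
      using bd by (intro mult_left_mono) auto
    moreover have "\<beta> * \<delta> / 2 / (f0 y)\<^sup>2 \<le> 2 * \<beta> * \<delta> * (2 / (f0 y)\<^sup>2)"
      using divide_right_mono[of "\<beta> * \<delta> / 2" "4 * (\<beta> * \<delta>)" "(f0 y)\<^sup>2"] bd by simp
    ultimately show "0 \<le> 2 * \<beta> * \<delta> * (- (2 * f0' y) / (f0 y) ^ 3) - \<phi>' y * (1 / 2 - T0 y)"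
      using B_deriv_le[OF y0] by linarith
  qed
  then show ?thesis using B_le_middle[of 3] s0.mode by (simp add: divide_inverse)
qed

lemma f0_B_le:
  assumes "x \<ge> 0"
  shows "(f0 x)\<^sup>2 * B x \<le> 92 * \<beta> * sqrt \<beta> * \<delta>"
proof -
  have bd: "\<beta> * \<delta> > 0" using beta delta_pos by simp
  have "\<beta> * \<delta> / (f0 x)\<^sup>2 \<ge> 0" using bd by simp
  then have "B x \<le> 9 * \<beta> * \<delta> + 2 * \<beta> * \<delta> / (f0 x)\<^sup>2"
    using B_le_left[of x] B_le_middle[of x] B_le_tail[of x] assms by linarith
  then have "(f0 x)\<^sup>2 * B x \<le> (f0 x)\<^sup>2 * (9 * \<beta> * \<delta> + 2 * \<beta> * \<delta> / (f0 x)\<^sup>2)"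
    by (intro mult_left_mono) auto
  also have "\<dots> = (f0 x)\<^sup>2 * (9 * \<beta> * \<delta>) + 2 * (\<beta> * \<delta>)"
    using s0.pos[OF assms] by (simp add: field_simps)
  also have "\<dots> \<le> 10 * sqrt \<beta> * (9 * \<beta> * \<delta>) + 2 * (\<beta> * \<delta> * sqrt \<beta>)"
    using s0.f2_le[OF assms] bd beta mult_left_mono[of 1 "sqrt \<beta>" "\<beta> * \<delta>"]
    by (intro add_mono mult_right_mono) auto
  finally show ?thesis by (simp add: algebra_simps)
qed

text \<open>The left side is \<open>(f0 x)\<^sup>2 * \<bar>1 - \<phi> x\<bar>\<close>;
  \<open>A\<close> handles \<open>\<phi> x \<le> 1\<close> and \<open>B\<close> the other case. The
  constant 446 is twice 223.\<close>

lemma pointwise_bound: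
  assumes "x \<ge> 0"
  shows "f0 x * \<bar>f0 x - f1 x\<bar> \<le> 446 * (\<beta> * sqrt \<beta>) * \<delta>"
proof (cases "\<phi> x \<le> 1")
  case True
  have "(\<phi> x)\<^sup>2 \<le> \<phi> x"
    using True phi_nonneg[OF assms] mult_left_mono[of "\<phi> x" 1 "\<phi> x"] by (simp add: power2_eq_square)
  then have "1 - \<phi> x \<le> 2 * A x" using A_ge[OF assms] by simp
  then have "(f0 x)\<^sup>2 * (1 - \<phi> x) \<le> (f0 x)\<^sup>2 * (2 * A x)" by (intro mult_left_mono) auto
  moreover have "\<bar>f0 x - f1 x\<bar> = f0 x * (1 - \<phi> x)"
    using True s0.pos[OF assms] f1_eq[OF assms] by (simp add: algebra_simps)
  ultimately show ?thesis using f0_A_le[OF assms] by (simp add: power2_eq_square mult.assoc)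
next
  case False
  have "\<phi> x - 1 \<le> 2 * B x" using B_ge[OF assms] by simp
  then have "(f0 x)\<^sup>2 * (\<phi> x - 1) \<le> (f0 x)\<^sup>2 * (2 * B x)" by (intro mult_left_mono) auto
  moreover have "f1 x - f0 x = f0 x * (\<phi> x - 1)"
    using f1_eq[OF assms] by (simp add: algebra_simps)
  moreover have "f0 x * (\<phi> x - 1) \<ge> 0" using False s0.pos[OF assms] by simp
  moreover have "\<beta> * sqrt \<beta> * \<delta> \<ge> 0" using beta delta_pos by simp
  ultimately show ?thesis using f0_B_le[OF assms]
    by (simp add: power2_eq_square mult.assoc abs_minus_commute)
qed

end

subsection \<open>Regularity of eigenfunctions\<close>

lemma C2c_has_vector_derivative:
  assumes "\<phi> \<in> C2c"
  shows "(\<phi> has_vector_derivative vector_derivative \<phi> (at x)) (at x)"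
    and "((\<lambda>y. vector_derivative \<phi> (at y)) has_vector_derivative
      vector_derivative (\<lambda>y. vector_derivative \<phi> (at y)) (at x)) (at x)"
    and "continuous_on UNIV (\<lambda>x. vector_derivative (\<lambda>y. vector_derivative \<phi> (at y)) (at x))"
proof -
  obtain f' f'' where d: "\<And>x. (\<phi> has_vector_derivative f' x) (at x)"
      "\<And>x. (f' has_vector_derivative f'' x) (at x)" "continuous_on UNIV f''"
    using assms unfolding C2c_def by blast
  have f': "vector_derivative \<phi> (at y) = f' y" for y by (rule vector_derivative_at[OF d(1)])
  have f'': "vector_derivative f' (at y) = f'' y" for y by (rule vector_derivative_at[OF d(2)])
  show "(\<phi> has_vector_derivative vector_derivative \<phi> (at x)) (at x)"
    and "((\<lambda>y. vector_derivative \<phi> (at y)) has_vector_derivative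
      vector_derivative (\<lambda>y. vector_derivative \<phi> (at y)) (at x)) (at x)"
    and "continuous_on UNIV (\<lambda>x. vector_derivative (\<lambda>y. vector_derivative \<phi> (at y)) (at x))"
    using d by (simp_all add: f' f'')
qed

lemma C2c_continuous_on: "\<phi> \<in> C2c \<Longrightarrow> continuous_on UNIV \<phi>"
  by (intro continuous_at_imp_continuous_on ballI)
    (rule has_vector_derivative_continuous[OF C2c_has_vector_derivative(1)])

lemma continuous_double_well: "continuous_on S double_well"
  unfolding double_well_def[abs_def] by (intro continuous_intros) auto

lemma schroedinger_expr_continuous_on:
  "\<phi> \<in> C2c \<Longrightarrow> continuous_on UNIV (schroedinger_expr \<beta> \<phi>)"
  unfolding schroedinger_expr_def[abs_def]
  by (intro continuous_intros C2c_has_vector_derivative(3) C2c_continuous_on continuous_double_well)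

text \<open>The complement of the support is open, so both derivatives vanish there. This gives the
  expression compact support and hence puts it in \<open>L2_fun\<close>.\<close>

lemma schroedinger_expr_eq_0:
  assumes "x \<notin> closure {x. \<phi> x \<noteq> 0}"
  shows "schroedinger_expr \<beta> \<phi> x = 0"
proof -
  let ?U = "- closure {x. \<phi> x \<noteq> 0}"
  have U: "open ?U" by auto
  have z: "\<phi> y = 0" if "y \<in> ?U" for y 
    using that closure_subset[of "{x. \<phi> x \<noteq> 0}"] by blast
  have deriv_0: "vector_derivative h (at y) = 0"
    if "\<And>z. z \<in> ?U \<Longrightarrow> h z = 0" "y \<in> ?U" for h :: "real \<Rightarrow> complex" and y
    by (rule vector_derivative_at,
        rule has_vector_derivative_transform_within_open[of "\<lambda>_. 0" 0 y ?U h])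
      (simp_all only: U that has_vector_derivative_const)
  have "vector_derivative (\<lambda>y. vector_derivative \<phi> (at y)) (at x) = 0"
    using assms by (intro deriv_0 z) auto
  then show ?thesis using z[of x] assms by (simp add: schroedinger_expr_def)
qed

lemma L2_fun_compact_support:
  fixes g :: "real \<Rightarrow> complex"
  assumes g: "continuous_on UNIV g" and K: "compact K" and zero: "\<And>x. x \<notin> K \<Longrightarrow> g x = 0"
  shows "g \<in> L2_fun"
proof -
  have "integrable lborel (\<lambda>x. indicator K x *\<^sub>R (cmod (g x))\<^sup>2)"
    by (intro borel_integrable_compact K continuous_intros continuous_on_subset[OF g]) auto
  moreover have "(\<lambda>x. indicator K x *\<^sub>R (cmod (g x))\<^sup>2) = (\<lambda>x. (cmod (g x))\<^sup>2)"
  proof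
    show "indicator K x *\<^sub>R (cmod (g x))\<^sup>2 = (cmod (g x))\<^sup>2" for x
      by (cases "x \<in> K") (simp_all add: zero)
  qed
  ultimately show ?thesis
    using borel_measurable_continuous_onI[OF g] by (simp add: L2_fun_def)
qed

lemma L2_fun_diff:
  assumes "f \<in> L2_fun" "g \<in> L2_fun"
  shows "integrable lborel (\<lambda>x. (cmod (f x - g x))\<^sup>2)"
proof (rule Bochner_Integration.integrable_bound)
  show "integrable lborel (\<lambda>x. 2 * (cmod (f x))\<^sup>2 + 2 * (cmod (g x))\<^sup>2)"
    using assms by (auto simp: L2_fun_def)
  show "(\<lambda>x. (cmod (f x - g x))\<^sup>2) \<in> borel_measurable lborel"
    using assms by (auto simp: L2_fun_def)
  have "(cmod (f x - g x))\<^sup>2 \<le> 2 * (cmod (f x))\<^sup>2 + 2 * (cmod (g x))\<^sup>2" for x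
  proof -
    have "(cmod (f x - g x))\<^sup>2 \<le> (cmod (f x) + cmod (g x))\<^sup>2"
      by (intro power_mono norm_triangle_ineq4) auto
    also have "\<dots> \<le> 2 * (cmod (f x))\<^sup>2 + 2 * (cmod (g x))\<^sup>2"
      using sum_squares_bound[of "cmod (f x)" "cmod (g x)"] by (simp add: power2_sum)
    finally show ?thesis .
  qed
  then show "AE x in lborel. norm ((cmod (f x - g x))\<^sup>2)
      \<le> norm (2 * (cmod (f x))\<^sup>2 + 2 * (cmod (g x))\<^sup>2)"
    by (intro AE_I2) (simp add: add_nonneg_nonneg)
qed

lemma integral_Re_square:
  fixes h :: "nat \<Rightarrow> real \<Rightarrow> complex"
  assumes int: "\<And>n. integrable lborel (\<lambda>x. (cmod (h n x))\<^sup>2)"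
    and meas: "\<And>n. h n \<in> borel_measurable lborel"
    and lim: "(\<lambda>n. L2_norm (h n)) \<longlonglongrightarrow> 0"
  shows "integrable lborel (\<lambda>x. (Re (h n x))\<^sup>2)"
    and "(\<lambda>n. LINT x|lborel. (Re (h n x))\<^sup>2) \<longlonglongrightarrow> 0"
proof -
  have le: "(Re (h n x))\<^sup>2 \<le> (cmod (h n x))\<^sup>2" for n x
    by (simp add: cmod_power2)
  show i: "integrable lborel (\<lambda>x. (Re (h n x))\<^sup>2)" for n
  proof (rule Bochner_Integration.integrable_bound[OF int[of n]])
    have [measurable]: "h n \<in> borel_measurable borel" using meas[of n] by simp
    show "(\<lambda>x. (Re (h n x))\<^sup>2) \<in> borel_measurable lborel" by measurable
  qed (simp add: le)
  show "(\<lambda>n. LINT x|lborel. (Re (h n x))\<^sup>2) \<longlonglongrightarrow> 0"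
  proof (rule tendsto_sandwich)
    show "\<forall>\<^sub>F n in sequentially. 0 \<le> (LINT x|lborel. (Re (h n x))\<^sup>2)" by simp
    have "(LINT x|lborel. (Re (h n x))\<^sup>2) \<le> (L2_norm (h n))\<^sup>2" for n
      using integral_mono[OF i int le, of n] by (simp add: L2_norm_def)
    then show "\<forall>\<^sub>F n in sequentially. (LINT x|lborel. (Re (h n x))\<^sup>2) \<le> (L2_norm (h n))\<^sup>2"
      by simp
    show "(\<lambda>n. (L2_norm (h n))\<^sup>2) \<longlonglongrightarrow> 0"
      using tendsto_power[OF lim, of 2] by simp
  qed simp
qed

text \<open>Since \<open>f\<close> and the coefficients are real, real parts of the approximants
  still converge. Integrability is recorded because the integral of a non-integrable function is 0
  by convention.\<close>

lemma H_graph_real_approximation: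
  fixes f :: "real \<Rightarrow> real"
  assumes graph: "(\<lambda>x. of_real (f x), \<lambda>x. of_real E * of_real (f x)) \<in> H_graph \<beta>"
  obtains p p' p'' :: "nat \<Rightarrow> real \<Rightarrow> real" where
    "\<And>n x. (p n has_real_derivative p' n x) (at x)"
    "\<And>n x. (p' n has_real_derivative p'' n x) (at x)"
    "\<And>n. continuous_on UNIV (p'' n)"
    "\<And>n. integrable lborel (\<lambda>x. (p n x - f x)\<^sup>2)"
    "(\<lambda>n. LINT x|lborel. (p n x - f x)\<^sup>2) \<longlonglongrightarrow> 0"
    "\<And>n. integrable lborel (\<lambda>x. (- (1 / (2 * \<beta>)) * p'' n x + \<beta> * double_well x * p n x - E * f x)\<^sup>2)"
    "(\<lambda>n. LINT x|lborel. (- (1 / (2 * \<beta>)) * p'' n x + \<beta> * double_well x * p n x - E * f x)\<^sup>2) \<longlonglongrightarrow> 0"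
proof -
  obtain \<phi> where L2: "(\<lambda>x. complex_of_real (f x)) \<in> L2_fun" "(\<lambda>x. of_real E * complex_of_real (f x)) \<in> L2_fun"
    and \<phi>: "\<And>n. \<phi> n \<in> C2c"
    and lim: "(\<lambda>n. L2_norm (\<lambda>x. \<phi> n x - of_real (f x))) \<longlonglongrightarrow> 0"
      "(\<lambda>n. L2_norm (\<lambda>x. schroedinger_expr \<beta> (\<phi> n) x - of_real E * of_real (f x))) \<longlonglongrightarrow> 0"
    using graph unfolding H_graph_def by auto
  have K: "compact (closure {x. \<phi> n x \<noteq> 0})" for n using \<phi>[of n] by (auto simp: C2c_def)
  have zero: "\<phi> n x = 0" if "x \<notin> closure {x. \<phi> n x \<noteq> 0}" for n x
    using that closure_subset[of "{x. \<phi> n x \<noteq> 0}"] by blast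
  have \<phi>_L2: "\<phi> n \<in> L2_fun" for n
    by (rule L2_fun_compact_support[OF C2c_continuous_on[OF \<phi>] K zero])
  have H_L2: "schroedinger_expr \<beta> (\<phi> n) \<in> L2_fun" for n
    by (rule L2_fun_compact_support[OF schroedinger_expr_continuous_on[OF \<phi>] K
          schroedinger_expr_eq_0])
  have meas: "g \<in> L2_fun \<Longrightarrow> g \<in> borel_measurable lborel" for g by (simp add: L2_fun_def)
  let ?p'' = "\<lambda>n x. vector_derivative (\<lambda>y. vector_derivative (\<phi> n) (at y)) (at x)"
  note v = integral_Re_square[OF L2_fun_diff[OF \<phi>_L2 L2(1)] borel_measurable_diff[OF meas[OF \<phi>_L2] meas[OF L2(1)]] lim(1)]
  note w = integral_Re_square[OF L2_fun_diff[OF H_L2 L2(2)] borel_measurable_diff[OF meas[OF H_L2] meas[OF L2(2)]] lim(2)]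
  have H: "Re (schroedinger_expr \<beta> (\<phi> n) x - of_real E * of_real (f x))
      = - (1 / (2 * \<beta>)) * Re (?p'' n x) + \<beta> * double_well x * Re (\<phi> n x) - E * f x" for n x
    by (simp add: schroedinger_expr_def)
  show ?thesis
  proof (rule that[of "\<lambda>n x. Re (\<phi> n x)" "\<lambda>n x. Re (vector_derivative (\<phi> n) (at x))"
        "\<lambda>n x. Re (?p'' n x)"])
    show "((\<lambda>x. Re (\<phi> n x)) has_real_derivative Re (vector_derivative (\<phi> n) (at x))) (at x)" for n x
      using bounded_linear.has_vector_derivative[OF bounded_linear_Re C2c_has_vector_derivative(1)[OF \<phi>]]
      by (simp add: has_real_derivative_iff_has_vector_derivative)
    show "((\<lambda>x. Re (vector_derivative (\<phi> n) (at x))) has_real_derivative Re (?p'' n x)) (at x)" for n x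
      using bounded_linear.has_vector_derivative[OF bounded_linear_Re C2c_has_vector_derivative(2)[OF \<phi>]]
      by (simp add: has_real_derivative_iff_has_vector_derivative)
    show "continuous_on UNIV (\<lambda>x. Re (?p'' n x))" for n
      by (intro continuous_intros C2c_has_vector_derivative(3) \<phi>)
    show "integrable lborel (\<lambda>x. (Re (\<phi> n x) - f x)\<^sup>2)" for n
      using v(1)[of n] by (simp only: minus_complex.sel Re_complex_of_real)
    show "(\<lambda>n. LINT x|lborel. (Re (\<phi> n x) - f x)\<^sup>2) \<longlonglongrightarrow> 0"
      using v(2) by (simp only: minus_complex.sel Re_complex_of_real)
  qed (rule w[unfolded H])+
qed

section \<open>Local convergence of the approximants\<close>

lemma real_antiderivative:
  fixes h :: "real \<Rightarrow> real"
  assumes "continuous_on UNIV h"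
  obtains H where "\<And>x. (H has_real_derivative h x) (at x)"
proof -
  have "isCont h x" for x using assms by (simp add: continuous_on_eq_continuous_at)
  then have "\<exists>H. \<forall>x. - \<infinity> < ereal x \<longrightarrow> ereal x < \<infinity> \<longrightarrow> (H has_vector_derivative h x) (at x)"
    by (intro einterval_antiderivative) auto
  then obtain H where "\<forall>x. (H has_vector_derivative h x) (at x)" by auto
  then have "(H has_real_derivative h x) (at x)" for x
    by (simp add: has_real_derivative_iff_has_vector_derivative)
  then show ?thesis by (rule that)
qed

text \<open>The pointwise bound \<open>\<bar>v\<bar> \<le> t + v\<^sup>2 / t\<close> with free
  \<open>t\<close> stands in for Cauchy-Schwarz.\<close>

lemma integral_abs_le_integral_square:
  fixes v :: "real \<Rightarrow> real"
  assumes v: "continuous_on UNIV v" and int: "integrable lborel (\<lambda>x. (v x)\<^sup>2)"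
    and "c \<le> x" "t > 0"
  shows "integral {c..x} (\<lambda>y. \<bar>v y\<bar>) \<le> t * (x - c) + (LINT y|lborel. (v y)\<^sup>2) / t"
proof -
  have cont: "continuous_on {c..x} v" using v continuous_on_subset by blast
  have i: "set_integrable lborel {c..x} (\<lambda>y. (v y)\<^sup>2)"
    unfolding set_integrable_def by (rule integrable_mult_indicator[OF _ int]) simp
  have "integral {c..x} (\<lambda>y. \<bar>v y\<bar>) \<le> integral {c..x} (\<lambda>y. t + (v y)\<^sup>2 / t)"
  proof (rule integral_le)
    fix y
    have "2 * t * \<bar>v y\<bar> \<le> t\<^sup>2 + (v y)\<^sup>2" using sum_squares_bound[of t "\<bar>v y\<bar>"] by simp
    moreover have "t * \<bar>v y\<bar> \<ge> 0" using \<open>t > 0\<close> by simp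
    ultimately have "t * \<bar>v y\<bar> \<le> t\<^sup>2 + (v y)\<^sup>2" by linarith
    then show "\<bar>v y\<bar> \<le> t + (v y)\<^sup>2 / t" using \<open>t > 0\<close> by (simp add: field_simps power2_eq_square)
  qed (use \<open>t > 0\<close> in \<open>auto intro!: integrable_continuous_interval continuous_intros cont\<close>)
  also have "\<dots> = t * (x - c) + integral {c..x} (\<lambda>y. (v y)\<^sup>2) / t"
  proof -
    have "integral {c..x} (\<lambda>y. t + (v y)\<^sup>2 / t)
        = integral {c..x} (\<lambda>y. t) + integral {c..x} (\<lambda>y. (v y)\<^sup>2 / t)"
      by (rule Henstock_Kurzweil_Integration.integral_add)
        (use \<open>t > 0\<close> in \<open>auto intro!: integrable_continuous_interval continuous_intros cont\<close>)
    then show ?thesis using \<open>c \<le> x\<close> by simp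
  qed
  also have "integral {c..x} (\<lambda>y. (v y)\<^sup>2) \<le> (LINT y|lborel. (v y)\<^sup>2)"
  proof -
    have "integral {c..x} (\<lambda>y. (v y)\<^sup>2) = (LINT y:{c..x}|lborel. (v y)\<^sup>2)"
      using set_borel_integral_eq_integral(2)[OF i] by simp
    also have "\<dots> \<le> (LINT y|lborel. (v y)\<^sup>2)"
      unfolding set_lebesgue_integral_def
      by (rule integral_mono[OF i[unfolded set_integrable_def] int]) (auto simp: indicator_def)
    finally show ?thesis .
  qed
  finally show ?thesis using \<open>t > 0\<close> by (simp add: divide_right_mono)
qed

lemma integral_abs_tendsto_0:
  fixes v :: "nat \<Rightarrow> real \<Rightarrow> real"
  assumes v: "\<And>n. continuous_on UNIV (v n)" and int: "\<And>n. integrable lborel (\<lambda>x. (v n x)\<^sup>2)"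
    and lim: "(\<lambda>n. LINT x|lborel. (v n x)\<^sup>2) \<longlonglongrightarrow> 0" and "c \<le> x"
  shows "(\<lambda>n. integral {c..x} (\<lambda>y. \<bar>v n y\<bar>)) \<longlonglongrightarrow> 0"
proof -
  define a where "a n = sqrt (LINT x|lborel. (v n x)\<^sup>2)" for n
  have a: "a n \<ge> 0" "(a n)\<^sup>2 = (LINT x|lborel. (v n x)\<^sup>2)" for n by (simp_all add: a_def)
  have a_lim: "a \<longlonglongrightarrow> 0" unfolding a_def[abs_def] using tendsto_real_sqrt[OF lim] by simp
  \<comment> \<open>The \<open>L2\<close> norm is a suitable choice of \<open>t\<close>; the
    vanishing extra term keeps it positive.\<close>
  define t where "t n = a n + inverse (real (Suc n))" for n
  have t: "t n > 0" "a n \<le> t n" for n using a(1)[of n] by (auto simp: t_def add_nonneg_pos)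
  have t_lim: "t \<longlonglongrightarrow> 0"
    unfolding t_def[abs_def] using tendsto_add[OF a_lim LIMSEQ_inverse_real_of_nat] by simp
  have le: "integral {c..x} (\<lambda>y. \<bar>v n y\<bar>) \<le> t n * (x - c) + t n" for n
  proof -
    have "(a n)\<^sup>2 \<le> (t n)\<^sup>2" using t(2)[of n] a(1)[of n] by (intro power_mono)
    then have "(a n)\<^sup>2 / t n \<le> t n" using t(1)[of n] by (simp add: divide_le_eq power2_eq_square)
    then show ?thesis
      using integral_abs_le_integral_square[OF v int \<open>c \<le> x\<close> t(1), of n n] a(2)[of n] by simp
  qed
  show ?thesis
  proof (rule tendsto_sandwich)
    show "\<forall>\<^sub>F n in sequentially. 0 \<le> integral {c..x} (\<lambda>y. \<bar>v n y\<bar>)"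
      by (auto intro!: always_eventually integral_nonneg integrable_continuous_interval
          continuous_intros continuous_on_subset[OF v])
    show "\<forall>\<^sub>F n in sequentially. integral {c..x} (\<lambda>y. \<bar>v n y\<bar>) \<le> t n * (x - c) + t n"
      using le by simp
    show "(\<lambda>n. t n * (x - c) + t n) \<longlonglongrightarrow> 0"
      using t_lim by (auto intro!: tendsto_eq_intros)
  qed simp
qed

text \<open>The remainder is measured by the integral of the absolute second derivative, since that
  is the sense in which the approximants converge.\<close>

lemma taylor_1_bound:
  fixes D D' g :: "real \<Rightarrow> real"
  assumes D: "\<And>y. (D has_real_derivative D' y) (at y)"
    and D': "\<And>y. (D' has_real_derivative g y) (at y)"
    and g: "continuous_on UNIV g" and "c \<le> x"
  shows "\<bar>D x - D c - D' c * (x - c)\<bar> \<le> integral {c..x} (\<lambda>y. \<bar>g y\<bar>) * (x - c)"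
proof -
  define M where "M = integral {c..x} (\<lambda>y. \<bar>g y\<bar>)"
  have gi: "continuous_on A g" for A using g continuous_on_subset by blast
  have bound: "\<bar>D' y - D' c\<bar> \<le> M" if y: "c \<le> y" "y \<le> x" for y
  proof -
    have "(g has_integral (D' y - D' c)) {c..y}"
      using D' y by (intro fundamental_theorem_of_calculus)
        (auto simp: has_real_derivative_iff_has_vector_derivative[symmetric]
          intro: has_field_derivative_at_within)
    then have "\<bar>D' y - D' c\<bar> = norm (integral {c..y} g)" by (simp add: integral_unique)
    also have "\<dots> \<le> integral {c..y} (\<lambda>y. \<bar>g y\<bar>)"
      by (rule integral_norm_bound_integral)
        (auto intro!: integrable_continuous_interval continuous_intros gi)
    also have "\<dots> \<le> M"
      unfolding M_def using y
      by (intro integral_subset_le) (auto intro!: integrable_continuous_interval continuous_intros gi)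
    finally show ?thesis .
  qed
  have "D' y \<le> D' c + M" "- D' y \<le> M - D' c" if "c \<le> y" "y \<le> x" for y
    using bound[OF that] by linarith+
  then have "D x - D c \<le> (D' c + M) * (x - c)" "- D x - (- D c) \<le> (M - D' c) * (x - c)"
    using increment_le_by_derivative[OF \<open>c \<le> x\<close> D]
      increment_le_by_derivative[OF \<open>c \<le> x\<close> DERIV_minus[OF D]] by blast+
  then show ?thesis unfolding M_def[symmetric] by (simp add: abs_le_iff algebra_simps)
qed

lemma AE_lborel_dense:
  fixes a b :: real
  assumes "AE x in lborel. P x" "a < b"
  obtains x where "a < x" "x < b" "P x"
proof -
  obtain N where N: "{x. \<not> P x} \<subseteq> N" "emeasure lborel N = 0" "N \<in> sets lborel"
    using AE_E[OF assms(1)] by auto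
  have "\<not> {a<..<b} \<subseteq> N"
  proof
    assume "{a<..<b} \<subseteq> N"
    then have "emeasure lborel {a<..<b} \<le> 0" using emeasure_mono[of "{a<..<b}" N lborel] N by simp
    then show False using assms(2) by simp
  qed
  then obtain x where "x \<in> {a<..<b}" "x \<notin> N" by blast
  then show ?thesis using that[of x] N(1) by auto
qed

text \<open>
  Along the approximating sequence the second derivatives converge in \<open>L\<^sup>1\<close> on bounded intervals, so
  the functions converge up to affine functions; a subsequence converging almost everywhere pins
  these down.
\<close>

lemma H_graph_affine_plus_antiderivative:
  fixes f U U' :: "real \<Rightarrow> real"
  assumes "\<beta> > 0" and graph: "(\<lambda>x. of_real (f x), \<lambda>x. of_real E * of_real (f x)) \<in> H_graph \<beta>"
    and f: "continuous_on UNIV f"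
    and U: "\<And>x. (U has_real_derivative U' x) (at x)"
    and U': "\<And>x. (U' has_real_derivative 2 * \<beta> * (\<beta> * double_well x - E) * f x) (at x)"
  obtains k s where "\<And>x. x > c \<Longrightarrow> f x = U x + k + s * x"
proof (rule H_graph_real_approximation[OF graph])
  fix p p' p'' assume p: "\<And>n x. (p n has_real_derivative p' n x) (at x)"
      "\<And>n x. (p' n has_real_derivative p'' n x) (at x)"
      "\<And>n. continuous_on UNIV (p'' n)"
    and v: "\<And>n. integrable lborel (\<lambda>x. (p n x - f x)\<^sup>2)"
      "(\<lambda>n. LINT x|lborel. (p n x - f x)\<^sup>2) \<longlonglongrightarrow> 0"
    and q: "\<And>n. integrable lborel
        (\<lambda>x. (- (1 / (2 * \<beta>)) * p'' n x + \<beta> * double_well x * p n x - E * f x)\<^sup>2)"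
      "(\<lambda>n. LINT x|lborel.
        (- (1 / (2 * \<beta>)) * p'' n x + \<beta> * double_well x * p n x - E * f x)\<^sup>2) \<longlonglongrightarrow> 0"
  define vn where "vn n x = p n x - f x" for n x
  define qn where "qn n x = - (1 / (2 * \<beta>)) * p'' n x + \<beta> * double_well x * p n x - E * f x" for n x
  have p_cont: "continuous_on UNIV (p n)" for n
    using p(1) by (auto intro!: continuous_at_imp_continuous_on DERIV_isCont)
  have vn_cont: "continuous_on UNIV (vn n)" for n
    unfolding vn_def[abs_def] by (intro continuous_intros p_cont f)
  have qn_cont: "continuous_on UNIV (qn n)" for n
    unfolding qn_def[abs_def] by (intro continuous_intros p_cont p continuous_double_well f)
  define D where "D n x = p n x - U x" for n x
  define D' where "D' n x = p' n x - U' x" for n x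
  \<comment> \<open>\<open>g n\<close> is the second derivative of \<open>D n\<close>, written
    through the errors \<open>vn\<close> and \<open>qn\<close>, both of which tend to zero in mean
    square.\<close>
  define g where "g n x = 2 * \<beta> * (\<beta> * double_well x * vn n x - qn n x)" for n x
  have g_eq: "g n x = p'' n x - 2 * \<beta> * (\<beta> * double_well x - E) * f x" for n x
    using \<open>\<beta> > 0\<close> by (simp add: g_def vn_def qn_def field_simps)
  have D: "(D n has_real_derivative D' n x) (at x)" for n x
    unfolding D_def[abs_def] D'_def by (intro DERIV_diff p U)
  have D': "(D' n has_real_derivative g n x) (at x)" for n x
    unfolding D'_def[abs_def] g_eq by (intro DERIV_diff p U')
  have g_cont: "continuous_on A (g n)" for A n
    unfolding g_def[abs_def]
    by (intro continuous_intros continuous_double_well continuous_on_subset[OF vn_cont]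
        continuous_on_subset[OF qn_cont]) auto
  have remainder: "(\<lambda>n. D n x - D n c - D' n c * (x - c)) \<longlonglongrightarrow> 0" if x: "c \<le> x" for x
  proof -
    have "compact (double_well ` {c..x})"
      by (intro compact_continuous_image continuous_double_well compact_Icc)
    then obtain w where w: "w > 0" "\<And>y. y \<in> {c..x} \<Longrightarrow> \<bar>double_well y\<bar> \<le> w"
      using bounded_pos[of "double_well ` {c..x}"] compact_imp_bounded by auto
    have vi: "(\<lambda>y. \<bar>vn n y\<bar>) integrable_on {c..x}" "(\<lambda>y. \<bar>qn n y\<bar>) integrable_on {c..x}" for n
      by (auto intro!: integrable_continuous_interval continuous_intros
          continuous_on_subset[OF vn_cont] continuous_on_subset[OF qn_cont])
    have g_le: "integral {c..x} (\<lambda>y. \<bar>g n y\<bar>)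
        \<le> 2 * \<beta> * \<beta> * w * integral {c..x} (\<lambda>y. \<bar>vn n y\<bar>) + 2 * \<beta> * integral {c..x} (\<lambda>y. \<bar>qn n y\<bar>)" for n
    proof -
      have "integral {c..x} (\<lambda>y. \<bar>g n y\<bar>)
          \<le> integral {c..x} (\<lambda>y. 2 * \<beta> * \<beta> * w * \<bar>vn n y\<bar> + 2 * \<beta> * \<bar>qn n y\<bar>)"
      proof (rule integral_le)
        show "(\<lambda>y. 2 * \<beta> * \<beta> * w * \<bar>vn n y\<bar> + 2 * \<beta> * \<bar>qn n y\<bar>) integrable_on {c..x}"
          by (intro integrable_continuous_interval continuous_intros
              continuous_on_subset[OF vn_cont] continuous_on_subset[OF qn_cont]) auto
        show "(\<lambda>y. \<bar>g n y\<bar>) integrable_on {c..x}"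
          by (intro integrable_continuous_interval continuous_intros g_cont)
        fix y assume y: "y \<in> {c..x}"
        have "\<bar>\<beta> * double_well y * vn n y - qn n y\<bar> \<le> \<bar>\<beta> * double_well y * vn n y\<bar> + \<bar>qn n y\<bar>"
          by (rule abs_triangle_ineq4)
        also have "\<bar>\<beta> * double_well y * vn n y\<bar> = \<beta> * \<bar>double_well y\<bar> * \<bar>vn n y\<bar>"
          using \<open>\<beta> > 0\<close> by (simp add: abs_mult)
        also have "\<dots> \<le> \<beta> * w * \<bar>vn n y\<bar>"
          using w(2)[OF y] \<open>\<beta> > 0\<close> by (intro mult_right_mono mult_left_mono) auto
        finally have "2 * \<beta> * \<bar>\<beta> * double_well y * vn n y - qn n y\<bar>
            \<le> 2 * \<beta> * (\<beta> * w * \<bar>vn n y\<bar> + \<bar>qn n y\<bar>)"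
          using \<open>\<beta> > 0\<close> by (intro mult_left_mono) auto
        then show "\<bar>g n y\<bar> \<le> 2 * \<beta> * \<beta> * w * \<bar>vn n y\<bar> + 2 * \<beta> * \<bar>qn n y\<bar>"
          using \<open>\<beta> > 0\<close> unfolding g_def abs_mult by (simp add: distrib_left mult.assoc)
      qed
      also have "\<dots> = integral {c..x} (\<lambda>y. 2 * \<beta> * \<beta> * w * \<bar>vn n y\<bar>)
          + integral {c..x} (\<lambda>y. 2 * \<beta> * \<bar>qn n y\<bar>)"
        using vi by (intro Henstock_Kurzweil_Integration.integral_add integrable_on_mult_right)
      finally show ?thesis by simp
    qed
    have v0: "(\<lambda>n. integral {c..x} (\<lambda>y. \<bar>vn n y\<bar>)) \<longlonglongrightarrow> 0"
      by (rule integral_abs_tendsto_0[OF vn_cont _ _ x]) (use v in \<open>simp_all add: vn_def\<close>)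
    have q0: "(\<lambda>n. integral {c..x} (\<lambda>y. \<bar>qn n y\<bar>)) \<longlonglongrightarrow> 0"
      by (rule integral_abs_tendsto_0[OF qn_cont _ _ x]) (use q in \<open>simp_all only: qn_def\<close>)
    show ?thesis
    proof (rule Lim_null_comparison)
      show "\<forall>\<^sub>F n in sequentially. norm (D n x - D n c - D' n c * (x - c))
          \<le> (2 * \<beta> * \<beta> * w * integral {c..x} (\<lambda>y. \<bar>vn n y\<bar>)
            + 2 * \<beta> * integral {c..x} (\<lambda>y. \<bar>qn n y\<bar>)) * (x - c)"
      proof (intro always_eventually allI)
        fix n
        have "norm (D n x - D n c - D' n c * (x - c)) \<le> integral {c..x} (\<lambda>y. \<bar>g n y\<bar>) * (x - c)"
          using taylor_1_bound[OF D D' g_cont x] by simp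
        also have "\<dots> \<le> (2 * \<beta> * \<beta> * w * integral {c..x} (\<lambda>y. \<bar>vn n y\<bar>)
            + 2 * \<beta> * integral {c..x} (\<lambda>y. \<bar>qn n y\<bar>)) * (x - c)"
          using g_le x by (intro mult_right_mono) auto
        finally show "norm (D n x - D n c - D' n c * (x - c)) \<le> \<dots>" .
      qed
      show "(\<lambda>n. (2 * \<beta> * \<beta> * w * integral {c..x} (\<lambda>y. \<bar>vn n y\<bar>)
            + 2 * \<beta> * integral {c..x} (\<lambda>y. \<bar>qn n y\<bar>)) * (x - c)) \<longlonglongrightarrow> 0"
        by (auto intro!: tendsto_eq_intros v0 q0)
    qed
  qed
  obtain r where r: "strict_mono (r :: nat \<Rightarrow> nat)"
    and ae: "AE x in lborel. (\<lambda>n. (p (r n) x - f x)\<^sup>2) \<longlonglongrightarrow> 0"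
    using tendsto_L1_AE_subseq[where u = "\<lambda>n x. (p n x - f x)\<^sup>2", OF v(1)] v(2) by auto
  define good where "good x \<longleftrightarrow> (\<lambda>n. p (r n) x) \<longlonglongrightarrow> f x" for x
  have "AE x in lborel. good x"
    using ae
  proof eventually_elim
    case (elim x)
    then have "(\<lambda>n. \<bar>p (r n) x - f x\<bar>) \<longlonglongrightarrow> 0"
      using tendsto_real_sqrt[OF elim] by simp
    then show ?case by (simp add: good_def tendsto_rabs_zero_iff LIM_zero_iff)
  qed
  note dense = AE_lborel_dense[OF this]
  define d where "d x = f x - U x" for x
  obtain a where a: "c < a" "good a" using dense[of c "c + 1"] by auto
  obtain b where b: "a < b" "good b" using dense[of a "a + 1"] by auto
  have line: "(\<lambda>n. D (r n) c + D' (r n) c * (x - c)) \<longlonglongrightarrow> d x" if "c \<le> x" "good x" for x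
  proof -
    have "(\<lambda>n. D (r n) x) \<longlonglongrightarrow> d x"
      using that(2) unfolding good_def D_def d_def by (intro tendsto_intros)
    from tendsto_diff[OF this LIMSEQ_subseq_LIMSEQ[OF remainder[OF that(1)] r]]
    show ?thesis by (simp add: o_def)
  qed
  define s where "s = (d b - d a) / (b - a)"
  have d_good: "d x = d a + s * (x - a)" if x: "c \<le> x" "good x" for x
  proof (rule LIMSEQ_unique[OF line[OF x]])
    let ?A = "\<lambda>n. D (r n) c + D' (r n) c * (a - c)"
    let ?B = "\<lambda>n. D (r n) c + D' (r n) c * (b - c)"
    have "(\<lambda>n. ?A n + (?B n - ?A n) / (b - a) * (x - a)) \<longlonglongrightarrow> d a + s * (x - a)"
      unfolding s_def using a b by (intro tendsto_intros line) auto
    \<comment> \<open>An affine function is the interpolation of its values at \<open>a\<close> and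
      \<open>b\<close>, so convergence at these two points determines the limit without separate
      limits of \<open>D\<close> and \<open>D'\<close> at \<open>c\<close>.\<close>
    moreover have "?A n + (?B n - ?A n) / (b - a) * (x - a) = D (r n) c + D' (r n) c * (x - c)" for n
    proof -
      have "?B n - ?A n = D' (r n) c * (b - a)" by (simp add: algebra_simps)
      then have "(?B n - ?A n) / (b - a) = D' (r n) c" using b by simp
      then show ?thesis by (simp add: algebra_simps)
    qed
    ultimately show "(\<lambda>n. D (r n) c + D' (r n) c * (x - c)) \<longlonglongrightarrow> d a + s * (x - a)"
      by (simp only:)
  qed
  \<comment> \<open>Good points are dense, so continuity carries the affine formula to every
    point.\<close>
  have "d x = d a + s * (x - a)" if x: "c < x" for x
  proof (rule ccontr)
    define e where "e y = d y - (d a + s * (y - a))" for y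
    assume "d x \<noteq> d a + s * (x - a)"
    then have "e x \<noteq> 0" by (simp add: e_def)
    moreover have "isCont e x"
      unfolding e_def[abs_def] d_def[abs_def] using f DERIV_isCont[OF U]
      by (intro continuous_intros) (auto simp: continuous_on_eq_continuous_at)
    ultimately obtain \<epsilon> where eps: "\<epsilon> > 0" "\<And>y. dist x y < \<epsilon> \<Longrightarrow> e y \<noteq> 0"
      using continuous_at_avoid[of x e 0] by auto
    obtain y where y: "x < y" "y < x + \<epsilon>" "good y" using dense[of x "x + \<epsilon>"] eps by auto
    then have "e y = 0" using d_good[of y] x by (simp add: e_def)
    then show False using eps(2)[of y] y by (simp add: dist_real_def)
  qed
  then have "f x = U x + (d a - s * a) + s * x" if "c < x" for x
    using that by (simp add: d_def algebra_simps)
  then show ?thesis using that by blast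
qed

lemma H_graph_eigenfunction_ode:
  fixes f :: "real \<Rightarrow> real"
  assumes "\<beta> > 0" and graph: "(\<lambda>x. of_real (f x), \<lambda>x. of_real E * of_real (f x)) \<in> H_graph \<beta>"
    and f: "continuous_on UNIV f"
  shows "(f has_real_derivative deriv f x) (at x)"
    and "(deriv f has_real_derivative 2 * \<beta> * (\<beta> * double_well x - E) * f x) (at x)"
proof -
  have "continuous_on UNIV (\<lambda>x. 2 * \<beta> * (\<beta> * double_well x - E) * f x)"
    by (intro continuous_intros continuous_double_well f)
  then obtain U' where U': "\<And>x. (U' has_real_derivative 2 * \<beta> * (\<beta> * double_well x - E) * f x) (at x)"
    using real_antiderivative by blast
  have "continuous_on UNIV U'" using U' by (auto intro!: continuous_at_imp_continuous_on DERIV_isCont)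
  then obtain U where U: "\<And>x. (U has_real_derivative U' x) (at x)"
    using real_antiderivative by blast
  \<comment> \<open>The base point \<open>x - 1\<close> places \<open>x\<close> inside the open half
    line; the dependence of \<open>k\<close> and \<open>s\<close> on it is harmless because
    differentiation is local.\<close>
  obtain k s where f_eq: "\<And>y. y > x - 1 \<Longrightarrow> f y = U y + k + s * y"
    using H_graph_affine_plus_antiderivative[OF assms U U', of "x - 1"] by blast
  have f': "(f has_real_derivative U' y + s) (at y)" if "y > x - 1" for y
  proof (rule has_field_derivative_transform_within_open[where S = "{x - 1<..}"])
    show "((\<lambda>y. U y + k + s * y) has_real_derivative U' y + s) (at y)"
      by (auto intro!: derivative_eq_intros U)
  qed (use that f_eq in auto)
  show "(f has_real_derivative deriv f x) (at x)"
    using f'[of x] DERIV_imp_deriv by fastforce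
  show "(deriv f has_real_derivative 2 * \<beta> * (\<beta> * double_well x - E) * f x) (at x)"
  proof (rule has_field_derivative_transform_within_open[where S = "{x - 1<..}"])
    show "((\<lambda>y. U' y + s) has_real_derivative 2 * \<beta> * (\<beta> * double_well x - E) * f x) (at x)"
      by (auto intro!: derivative_eq_intros U')
  qed (use DERIV_imp_deriv[OF f'] in auto)
qed

section \<open>Normalisation and assembly\<close>

lemma even_density_tail:
  fixes g :: "real \<Rightarrow> real"
  assumes g: "continuous_on UNIV g" and int: "integrable lborel g"
    and total: "(LINT x|lborel. g x) = 1" and even: "\<And>x. g (- x) = g x"
  obtains T where "\<And>x. (T has_real_derivative - g x) (at x)" "T 0 = 1 / 2" "(T \<longlongrightarrow> 0) at_top"
proof -
  obtain G where G: "\<And>x. (G has_real_derivative g x) (at x)"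
    using real_antiderivative[OF g] by blast
  have "((\<lambda>x. G x + G (- x)) has_real_derivative 0) (at x)" for x
    using DERIV_add[OF G DERIV_chain2[OF G[of "- x"] DERIV_minus[OF DERIV_ident]]]
    by (simp add: even)
  \<comment> \<open>\<open>G - G 0\<close> is odd, so the mass on \<open>[0, x]\<close> is half of
    that on the symmetric interval.\<close>
  then have odd: "G x + G (- x) = 2 * G 0" for x
    using DERIV_isconst_all[of "\<lambda>x. G x + G (- x)" x 0] by simp
  have "((\<lambda>x. LINT y|lborel. g y * indicator {- x..x} y) \<longlongrightarrow> (LINT y|lborel. g y)) at_top"
  proof (rule integral_dominated_convergence_at_top)
    show "integrable lborel (\<lambda>y. norm (g y))" using int by simp
    show "AE y in lborel. ((\<lambda>x. g y * indicator {- x..x} y) \<longlongrightarrow> g y) at_top"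
    proof (rule AE_I2, rule tendsto_eventually)
      show "\<forall>\<^sub>F x in at_top. g y * indicator {- x..x} y = g y" for y
        using eventually_ge_at_top[of "\<bar>y\<bar>"] by eventually_elim (auto simp: indicator_def)
    qed
  qed (use int in \<open>auto simp: indicator_def\<close>)
  moreover have "(LINT y|lborel. g y * indicator {- x..x} y) = G x - G (- x)" if "x \<ge> 0" for x
    using that G g by (intro integral_FTC_Icc_real) (auto simp: continuous_on_eq_continuous_at)
  ultimately have lim: "((\<lambda>x. G x - G (- x)) \<longlongrightarrow> 1) at_top"
    using total by (auto elim!: Lim_transform_eventually
        intro!: eventually_mono[OF eventually_ge_at_top[of 0]])
  show ?thesis
  proof (rule that[of "\<lambda>x. 1 / 2 - (G x - G 0)"])
    show "((\<lambda>x. 1 / 2 - (G x - G 0)) has_real_derivative - g x) (at x)" for x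
      by (auto intro!: derivative_eq_intros G)
    have "((\<lambda>x. 1 / 2 - (G x - G (- x)) / 2) \<longlongrightarrow> 0) at_top"
      using tendsto_diff[OF tendsto_const[of "1 / 2"] tendsto_divide[OF lim tendsto_const[of 2]]]
      by simp
    moreover have "1 / 2 - (G x - G (- x)) / 2 = 1 / 2 - (G x - G 0)" for x
      using odd[of x] by (simp add: field_simps)
    ultimately show "((\<lambda>x. 1 / 2 - (G x - G 0)) \<longlongrightarrow> 0) at_top" by simp
  qed simp
qed

lemma eigensystem_half_line_state:
  assumes sys: "eigensystem \<beta> E \<psi>" and "\<beta> \<ge> 1" and pos: "\<And>x. x > 0 \<Longrightarrow> \<psi> k x > 0"
  obtains T where "half_line_state \<beta> (E k) (\<psi> k) (deriv (\<psi> k)) T"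
proof -
  have cont: "continuous_on UNIV (\<psi> k)"
    and graph: "(\<lambda>x. of_real (\<psi> k x), \<lambda>x. of_real (E k) * of_real (\<psi> k x)) \<in> H_graph \<beta>"
    and parity: "\<And>x. \<psi> k (- x) = (- 1) ^ k * \<psi> k x"
    using sys by (auto simp: eigensystem_def)
  have "(LINT x|lborel. cnj (of_real (\<psi> k x)) * of_real (\<psi> k x)) = (1 :: complex)"
    using sys by (auto simp: eigensystem_def L2_orthonormal_basis_def L2_inner_def)
  then have "(LINT x|lborel. complex_of_real ((\<psi> k x)\<^sup>2)) = 1"
    by (simp add: power2_eq_square)
  then have total: "(LINT x|lborel. (\<psi> k x)\<^sup>2) = 1"
    by (simp only: integral_complex_of_real of_real_eq_1_iff)
  \<comment> \<open>A non-integrable function would have integral 0 rather than 1.\<close>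
  then have int: "integrable lborel (\<lambda>x. (\<psi> k x)\<^sup>2)"
    using not_integrable_integral_eq by fastforce
  have "(\<psi> k (- x))\<^sup>2 = (\<psi> k x)\<^sup>2" for x
    by (simp add: parity power_mult_distrib flip: power_mult)
  then obtain T where T: "\<And>x. (T has_real_derivative - (\<psi> k x)\<^sup>2) (at x)" "T 0 = 1 / 2"
      "(T \<longlongrightarrow> 0) at_top"
    using even_density_tail[OF continuous_on_power[OF cont] int total] by blast
  have "\<beta> > 0" using \<open>\<beta> \<ge> 1\<close> by simp
  note ode = H_graph_eigenfunction_ode[OF this graph cont]
  show ?thesis
    by (rule that[of T], rule half_line_state.intro)
      (rule \<open>\<beta> \<ge> 1\<close> ode T | rule pos, assumption)+
qed

theorem theorem3p6:
  "\<exists>C::real. 0 < C \<and>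
     (\<forall>\<beta>\<ge>1. \<forall>E \<psi>. eigensystem \<beta> E \<psi> \<longrightarrow>
        (SUP x\<in>{0..}. ereal (\<psi> 0 x * \<bar>\<psi> 0 x - \<psi> 1 x\<bar>))
          \<le> ereal (C * \<beta> powr (3 / 2) * (E 1 - E 0)))"
proof (intro exI[of _ 446] conjI allI impI)
  fix \<beta> :: real and E \<psi>
  assume beta: "\<beta> \<ge> 1" and sys: "eigensystem \<beta> E \<psi>"
  have pos: "\<psi> 0 x > 0" "x > 0 \<Longrightarrow> \<psi> 1 x > 0" and even: "\<psi> 0 (- x) = \<psi> 0 x" for x
    using sys by (auto simp: eigensystem_def)
  obtain T0 where s0: "half_line_state \<beta> (E 0) (\<psi> 0) (deriv (\<psi> 0)) T0"
    using eigensystem_half_line_state[OF sys beta pos(1)] .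
  obtain T1 where s1: "half_line_state \<beta> (E 1) (\<psi> 1) (deriv (\<psi> 1)) T1"
    using eigensystem_half_line_state[OF sys beta pos(2)] .
  have d: "(\<psi> 0 has_real_derivative deriv (\<psi> 0) 0) (at 0)"
    using half_line_state.f_deriv[OF s0, of 0] by simp
  \<comment> \<open>Reflection changes the sign of the derivative at 0 but leaves the even ground
    state fixed, so this derivative vanishes.\<close>
  then have "((\<lambda>x. \<psi> 0 (- x)) has_real_derivative deriv (\<psi> 0) 0 * - 1) (at 0)"
    using DERIV_mirror[of "\<psi> 0" "deriv (\<psi> 0) 0" 0] by simp
  then have "(\<psi> 0 has_real_derivative deriv (\<psi> 0) 0 * - 1) (at 0)" by (simp only: even)
  from DERIV_unique[OF d this] have deriv_0: "deriv (\<psi> 0) 0 = 0" by simp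
  interpret half_line_pair \<beta> "E 0" "E 1" "\<psi> 0" "deriv (\<psi> 0)" T0 "\<psi> 1" "deriv (\<psi> 1)" T1
  proof (intro half_line_pair.intro half_line_ground_state.intro s0 s1)
    show "half_line_ground_state_axioms (\<psi> 0) (deriv (\<psi> 0))"
      by unfold_locales (use deriv_0 pos in auto)
    have "E 0 < E 1" using sys by (auto simp: eigensystem_def strict_mono_def)
    then show "half_line_pair_axioms (E 0) (E 1)" by unfold_locales
  qed
  have "\<beta> powr (3 / 2) = \<beta> powr (1 + 1 / 2)" by simp
  also have "\<dots> = \<beta> * sqrt \<beta>" using beta by (simp only: powr_add) (simp add: powr_half_sqrt)
  finally show "(SUP x\<in>{0..}. ereal (\<psi> 0 x * \<bar>\<psi> 0 x - \<psi> 1 x\<bar>))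
      \<le> ereal (446 * \<beta> powr (3 / 2) * (E 1 - E 0))"
    using pointwise_bound by (intro SUP_least) (simp add: mult.assoc)
qed simp

end
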